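(* Let $\varphi_1,\dots,\varphi_N$ be contractive similitudes of $\mathbb{R}^d$, and let $(K,\{a,b\})$ be the attractor of a linear IFS with condensation $$\tilde{\mathcal{S}}=\{(C_1,\{a_1,b_1\}),\dots,(C_m,\{a_m,b_m\});\varphi_1,\dots,\varphi_N\},$$ with associated zipper decomposition $(K,\{a,b\})=A_1+A_2+\cdots+A_{m+N}$, where $A_1,\dots,A_{m+N}$ is a rearrangement of the buttons $(C_j,\{a_j,b_j\})$, $1\le j\le m$, and $(\varphi_i(K),\{\varphi_i(a),\varphi_i(b)\})$, $1\le i\le N$. Let $E$ be the attractor of the IFS $\{\varphi_i\}_{i=1}^N$, i.e. the unique nonempty compact set with $E=\bigcup_{i=1}^N\varphi_i(E)$. Suppose that: (i) $A_1,A_{m+N}\in\{(C_1,\{a_1,b_1\}),\dots,(C_m,\{a_m,b_m\})\}$; (ii) $\dim_H E>1$. Then $K$ is a Whitney set.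
   Context: A contractive similitude of $\mathbb{R}^d$ is a map $\varphi$ with $|\varphi(x)-\varphi(y)|=\rho|x-y|$ for all $x,y$, for some $\rho\in(0,1)$. $\dim_H$ denotes Hausdorff dimension. Whitney set: a compact connected set $F\subset\mathbb{R}^d$ for which there is a $C^1$ function $f:\mathbb{R}^d\to\mathbb{R}$ such that $\nabla f(x)=0$ for all $x\in F$ and $f|_F$ is not constant. Button: for a compact set $A$ and two points $a,b\in A$, the pair $(A,\{a,b\})$ is called a button with endpoints $a$ and $b$ (the set of endpoints is unordered). A button $(A',\{a',b'\})$ with $A'\subset A$ is a sub-button of $(A,\{a,b\})$. Zipper decomposition: $(A,\{a,b\})=(A_1,\{a_1,b_1\})+\cdots+(A_n,\{a_n,b_n\})$ is a zipper decomposition of $(A,\{a,b\})$ if, for a suitable naming of the endpoints of each button, (1) $A=\bigcup_{\ell=1}^n A_\ell$ and all $(A_\ell,\{a_\ell,b_\ell\})$ are sub-buttons of $(A,\{a,b\})$; (2) $a=a_1$, $b_\ell=a_{\ell+1}$ for $1\le\ell\le n-1$, and $b_n=b$; (3) for $\ell',\ell''\in\{1,\dots,n\}$, $A_{\ell'}\cap A_{\ell''}=\emptyset$ if $|\ell'-\ell''|>1$, and $A_{\ell'}\cap A_{\ell''}$ consists of exactly one point if $|\ell'-\ell''|=1$. Linear IFS with condensation: let $C=\bigcup_{j=1}^m C_j\subset\mathbb{R}^d$, $m\ge2$, be a disjoint union of compact connected sets $C_j$ (the connected components of $C$), and let $K$ be the unique nonempty compact set with $K=C\cup\bigcup_{i=1}^N\varphi_i(K)$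 (the attractor of the IFS with condensation $\{C;\varphi_1,\dots,\varphi_N\}$). If there exist $\{a,b\}\subseteq K$ and $\{a_j,b_j\}\subseteq C_j$ for $1\le j\le m$ such that $(K,\{a,b\})=A_1+\cdots+A_{m+N}$ is a zipper decomposition, where $A_1,\dots,A_{m+N}$ is a rearrangement of $(C_1,\{a_1,b_1\}),\dots,(C_m,\{a_m,b_m\}),(\varphi_1(K),\{\varphi_1(a),\varphi_1(b)\}),\dots,(\varphi_N(K),\{\varphi_N(a),\varphi_N(b)\})$, then $\tilde{\mathcal{S}}=\{(C_1,\{a_1,b_1\}),\dots,(C_m,\{a_m,b_m\});\varphi_1,\dots,\varphi_N\}$ is called a linear IFS with condensation and $(K,\{a,b\})$ is called its attractor. *)

theory Defs
  imports "HOL-Analysis.Analysis" "HOL-Library.Multiset"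
begin

definition contractive_similitude :: "('a::metric_space \<Rightarrow> 'a) \<Rightarrow> bool" where
  "contractive_similitude \<phi> \<longleftrightarrow>
     (\<exists>\<rho>. 0 < \<rho> \<and> \<rho> < 1 \<and> (\<forall>x y. dist (\<phi> x) (\<phi> y) = \<rho> * dist x y))"

section \<open>Hausdorff measure and dimension\<close>

(* The case distinctions implement diam({})^s = 0 for every s, and diam(U)^0 = 1 for nonempty U
   (whereas 0 powr 0 = 0).  Boundedness is required because diameter is only meaningful for
   bounded sets. *)
definition hausdorff_premeasure :: "real \<Rightarrow> real \<Rightarrow> 'a::metric_space set \<Rightarrow> ennreal" where
  "hausdorff_premeasure s \<delta> A =
     (INF U \<in> {U :: nat \<Rightarrow> 'a set. A \<subseteq> (\<Union>i. U i) \<and> (\<forall>i. bounded (U i) \<and> diameter (U i) \<le> \<delta>)}.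
        \<Sum>i. if U i = {} then 0 else if s = 0 then 1 else ennreal (diameter (U i) powr s))"

definition hausdorff_measure :: "real \<Rightarrow> 'a::metric_space set \<Rightarrow> ennreal" where
  "hausdorff_measure s A = (SUP \<delta>\<in>{0<..}. hausdorff_premeasure s \<delta> A)"

definition hausdorff_dim :: "'a::metric_space set \<Rightarrow> ennreal" where
  "hausdorff_dim A = (INF s\<in>{s. 0 \<le> s \<and> hausdorff_measure s A = 0}. ennreal s)"

section \<open>Whitney sets\<close>

(* g is the gradient of f; its continuity says that f is C^1. *)
definition Whitney_set :: "'a::euclidean_space set \<Rightarrow> bool" where
  "Whitney_set F \<longleftrightarrow> compact F \<and> connected F \<and>
     (\<exists>(f :: 'a \<Rightarrow> real) g.
        (\<forall>x. GDERIV f x :> g x) \<and> continuous_on UNIV g \<and>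
        (\<forall>x\<in>F. g x = 0) \<and> \<not> f constant_on F)"

section \<open>Buttons and zipper decompositions\<close>

(* A pair (A, {a, b}): the underlying set and the unordered set of endpoints. *)
type_synonym 'a button = "'a set \<times> 'a set"

definition is_button :: "'a::topological_space button \<Rightarrow> bool" where
  "is_button B \<longleftrightarrow> compact (fst B) \<and> (\<exists>a b. a \<noteq> b \<and> snd B = {a, b}) \<and> snd B \<subseteq> fst B"

definition sub_button :: "'a::topological_space button \<Rightarrow> 'a button \<Rightarrow> bool" where
  "sub_button B' B \<longleftrightarrow> is_button B' \<and> is_button B \<and> fst B' \<subseteq> fst B"

definition image_button :: "('a \<Rightarrow> 'a) \<Rightarrow> 'a button \<Rightarrow> 'a button" where
  "image_button \<phi> B = (\<phi> ` fst B, \<phi> ` snd B)"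

(* The pieces are As ! 0, ..., As ! (n - 1); the functions p and q choose the naming of the
   endpoints of each piece as its first and second endpoint. *)
definition zipper_decomposition :: "'a::topological_space button \<Rightarrow> 'a button list \<Rightarrow> bool" where
  "zipper_decomposition B As \<longleftrightarrow>
     (let n = length As in
        n \<ge> 1 \<and>
        fst B = (\<Union>l<n. fst (As ! l)) \<and>
        (\<forall>l<n. sub_button (As ! l) B) \<and>
        (\<exists>a b. \<exists>p q :: nat \<Rightarrow> 'a.
           snd B = {a, b} \<and> (\<forall>l<n. snd (As ! l) = {p l, q l}) \<and>
           a = p 0 \<and> (\<forall>l. Suc l < n \<longrightarrow> q l = p (Suc l)) \<and> q (n - 1) = b) \<and>
        (\<forall>l<n. \<forall>l'<n.
           (\<bar>int l - int l'\<bar> > 1 \<longrightarrow> fst (As ! l) \<inter> fst (As ! l') = {}) \<and>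
           (\<bar>int l - int l'\<bar> = 1 \<longrightarrow> (\<exists>x. fst (As ! l) \<inter> fst (As ! l') = {x}))))"

section \<open>Attractors and linear IFS with condensation\<close>

(* An IFS is given by the list of its maps.  When these are contractions, there is exactly one
   nonempty compact set with the stated property, in this definition and in the next one. *)
definition ifs_attractor :: "('a::topological_space \<Rightarrow> 'a) list \<Rightarrow> 'a set \<Rightarrow> bool" where
  "ifs_attractor \<phi>s E \<longleftrightarrow> E \<noteq> {} \<and> compact E \<and> E = (\<Union>\<phi>\<in>set \<phi>s. \<phi> ` E)"

definition condensation_attractor ::
  "'a::topological_space set \<Rightarrow> ('a \<Rightarrow> 'a) list \<Rightarrow> 'a set \<Rightarrow> bool" where
  "condensation_attractor C \<phi>s K \<longleftrightarrow> K \<noteq> {} \<and> compact K \<and> K = C \<union> (\<Union>\<phi>\<in>set \<phi>s. \<phi> ` K)"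

(* Cs lists the buttons (C_j, {a_j, b_j}), B is the attractor (K, {a, b}) and As the associated
   zipper decomposition.  Since the C_j are nonempty, compact, connected and pairwise disjoint,
   they are the connected components of their union. *)
definition linear_ifs_condensation ::
  "'a::topological_space button list \<Rightarrow> ('a \<Rightarrow> 'a) list \<Rightarrow> 'a button \<Rightarrow> 'a button list \<Rightarrow> bool" where
  "linear_ifs_condensation Cs \<phi>s B As \<longleftrightarrow>
     length Cs \<ge> 2 \<and>
     (\<forall>c\<in>set Cs. is_button c \<and> connected (fst c)) \<and>
     (\<forall>i<length Cs. \<forall>j<length Cs. i \<noteq> j \<longrightarrow> fst (Cs ! i) \<inter> fst (Cs ! j) = {}) \<and>
     condensation_attractor (\<Union>c\<in>set Cs. fst c) \<phi>s (fst B) \<and>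
     is_button B \<and>
     mset As = mset (Cs @ map (\<lambda>\<phi>. image_button \<phi> B) \<phi>s) \<and>
     zipper_decomposition B As"

end

theory Submission
  imports Defs
begin

text \<open>
  Let \<open>\<rho>\<^sub>1, \<dots>, \<rho>\<^sub>N\<close> be the ratios of the similitudes.  If \<open>\<Sum> \<rho>\<^sub>i\<^sup>t < 1\<close>, then the covers of \<open>E\<close> by the images
  of \<open>E\<close> under all words of length \<open>k\<close> show that \<open>E\<close> has \<open>t\<close>-dimensional Hausdorff measure zero.
  So \<open>dim\<^sub>H E > 1\<close> provides an exponent \<open>t > 1\<close> with \<open>\<Sum> \<rho>\<^sub>i\<^sup>t \<ge> 1\<close>, and after normalisation weights
  \<open>p\<^sub>i\<close> with \<open>\<Sum> p\<^sub>i = 1\<close> and \<open>p\<^sub>i \<le> q \<rho>\<^sub>i\<close> for some \<open>q < 1\<close>.  With these weights there is a devil's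
  staircase on \<open>K\<close>: a function that is constant on every copy of a condensation component and whose
  variation over \<open>\<phi>\<^sub>i(K)\<close> is the fraction \<open>p\<^sub>i\<close> of its total variation.  Since \<open>\<phi>\<^sub>i\<close> multiplies
  increments by \<open>p\<^sub>i\<close> but lengths only by \<open>\<rho>\<^sub>i > p\<^sub>i\<close>, the staircase is flat at every point of \<open>K\<close>.

  The staircase has to be extended to a function of class \<open>C\<^sup>1\<close> on the whole space with gradient zero on
  \<open>K\<close>.  Rather than through an extension theorem, the extension is obtained at once as a limit of
  iterates of an operator on \<open>C\<^sup>1\<close> functions,
  \<open>T f = \<Sum> p\<^sub>i (\<kappa>\<^sub>i \<cdot> \<epsilon>\<^sub>i \<cdot> (f \<circ> \<phi>\<^sub>i\<^sup>-\<^sup>1) + (1 - \<kappa>\<^sub>i) \<cdot> u\<^sub>i)\<close>.  All functions considered are \<open>-1\<close> on the first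
  piece of the zipper and \<open>1\<close> on the last one.  The summand for \<open>i\<close> reproduces \<open>f\<close> on \<open>\<phi>\<^sub>i(K)\<close>, up to the
  sign \<open>\<epsilon>\<^sub>i\<close> that accounts for the direction in which the zipper runs through \<open>\<phi>\<^sub>i(K)\<close>, and it is \<open>-1\<close>
  on the pieces before \<open>\<phi>\<^sub>i(K)\<close> and \<open>1\<close> on those after it: \<open>u\<^sub>i\<close> is a smooth step function and \<open>\<kappa>\<^sub>i\<close> a
  cutoff function.  The gluing is possible because the first and the last piece are condensation
  components: \<open>f\<close> is constant on these two pieces, which contain the endpoints of \<open>K\<close>, so the
  neighbours of \<open>\<phi>\<^sub>i(K)\<close> touch it only where \<open>f \<circ> \<phi>\<^sub>i\<^sup>-\<^sup>1\<close> is constant; the image under \<open>\<phi>\<^sub>i\<close> of the union of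
  the inner pieces has a positive distance from all other pieces, which leaves room for a cutoff.

  The supports of the \<open>\<kappa>\<^sub>i\<close> are disjoint.  Hence \<open>T\<close> contracts the supremum norm by \<open>q\<close> and contracts
  gradients by \<open>p\<^sub>i / \<rho>\<^sub>i \<le> q\<close>, up to a multiple of the supremum norm (lemmas \<open>T_contract\<close> and
  \<open>T'_contract\<close>), so the iterates converge together with their gradients.  On \<open>K\<close> the terms with
  derivatives of \<open>\<kappa>\<^sub>i\<close> and \<open>u\<^sub>i\<close> vanish, so there the gradient shrinks by the factor \<open>q\<close> in every step
  (lemma \<open>T'_on_K\<close>), and the gradient of the limit is zero on \<open>K\<close>.  The limit is \<open>-1\<close> on the first piece
  and \<open>1\<close> on the last one.

  It remains to see that \<open>K\<close> is connected: a function on \<open>K\<close> that is locally constant at some scale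
  \<open>\<eta>\<close> is constant on every condensation component, and pulled back by \<open>\<phi>\<^sub>i\<close> it is locally constant at
  the larger scale \<open>\<eta> / \<rho>\<^sub>i\<close>.
\<close>

section \<open>Cutoff functions of class \<open>C\<^sup>1\<close>\<close>

definition has_C1_gradient :: "('a::euclidean_space \<Rightarrow> real) \<Rightarrow> ('a \<Rightarrow> 'a) \<Rightarrow> bool" where
  "has_C1_gradient f g \<longleftrightarrow> (\<forall>x. GDERIV f x :> g x) \<and> continuous_on UNIV g"

lemma has_C1_gradient_continuous:
  assumes "has_C1_gradient f g"
  shows "continuous_on S f"
  using assms unfolding has_C1_gradient_def gderiv_def
  by (meson has_derivative_continuous_on has_derivative_at_withinI)

lemma has_C1_gradient_const: "has_C1_gradient (\<lambda>x. c) (\<lambda>x. 0)"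
  by (simp add: has_C1_gradient_def GDERIV_const)

lemma has_C1_gradient_add:
  assumes "has_C1_gradient f f'" "has_C1_gradient g g'"
  shows "has_C1_gradient (\<lambda>x. f x + g x) (\<lambda>x. f' x + g' x)"
  using assms by (auto simp: has_C1_gradient_def intro!: GDERIV_add continuous_intros)

lemma has_C1_gradient_mult:
  assumes "has_C1_gradient f f'" "has_C1_gradient g g'"
  shows "has_C1_gradient (\<lambda>x. f x * g x) (\<lambda>x. f x *\<^sub>R g' x + g x *\<^sub>R f' x)"
  using assms has_C1_gradient_continuous[OF assms(1)] has_C1_gradient_continuous[OF assms(2)]
  by (auto simp: has_C1_gradient_def intro!: GDERIV_mult continuous_intros)

lemma has_C1_gradient_cmult:
  assumes "has_C1_gradient f f'"
  shows "has_C1_gradient (\<lambda>x. c * f x) (\<lambda>x. c *\<^sub>R f' x)"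
  using has_C1_gradient_mult[OF has_C1_gradient_const assms] by simp

lemma has_C1_gradient_sum:
  assumes "\<And>i. i \<in> I \<Longrightarrow> has_C1_gradient (f i) (f' i)"
  shows "has_C1_gradient (\<lambda>x. \<Sum>i\<in>I. f i x) (\<lambda>x. \<Sum>i\<in>I. f' i x)"
  using assms
  by (induction I rule: infinite_finite_induct)
    (auto intro: has_C1_gradient_add simp: has_C1_gradient_const)

lemma has_C1_gradient_compose_real:
  assumes f: "has_C1_gradient f f'"
    and h: "\<And>y. (h has_real_derivative h' y) (at y)" and h': "continuous_on UNIV h'"
  shows "has_C1_gradient (\<lambda>x. h (f x)) (\<lambda>x. h' (f x) *\<^sub>R f' x)"
proof -
  have "continuous_on UNIV (\<lambda>x. h' (f x))"
    using continuous_on_compose2[OF h' has_C1_gradient_continuous[OF f]] by simp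
  with f h show ?thesis
    by (simp add: has_C1_gradient_def GDERIV_DERIV_compose continuous_on_scaleR)
qed

lemma has_C1_gradient_dist_square:
  "has_C1_gradient (\<lambda>x. (dist x c)\<^sup>2) (\<lambda>x. 2 *\<^sub>R (x - c))"
  unfolding has_C1_gradient_def gderiv_def dist_norm power2_norm_eq_inner
  by (auto intro!: derivative_eq_intros continuous_intros simp: inner_commute)

text \<open>
  Composed with squared distances and with sums of bumps, this one-sided parabola yields all cutoff
  functions below.  Squaring the truncated linear function removes its corner at \<open>1\<close>.
\<close>

definition quad_hat :: "real \<Rightarrow> real" where
  "quad_hat y = (max 0 (1 - y))\<^sup>2"

lemma quad_hat_deriv:
  "(quad_hat has_real_derivative - 2 * max 0 (1 - y)) (at y)"
proof -
  \<comment> \<open>The derivative is Lipschitz with constant \<open>2\<close>, so the Taylor remainder is at most quadratic.\<close>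
  have taylor: "\<bar>quad_hat z - quad_hat y - (- 2 * max 0 (1 - y)) * (z - y)\<bar> \<le> \<bar>z - y\<bar>\<^sup>2" for z
  proof (cases "z \<le> 1"; cases "y \<le> 1")
    assume "z \<le> 1" "\<not> y \<le> 1"
    moreover from this have "(1 - z)\<^sup>2 \<le> (y - z)\<^sup>2" by (intro power_mono) auto
    ultimately show ?thesis by (simp add: quad_hat_def power2_commute)
  next
    assume "\<not> z \<le> 1" "y \<le> 1"
    moreover from this have "0 \<le> (z - 1) * (1 - y)" "0 \<le> (1 - y)\<^sup>2" "0 \<le> (z - 1)\<^sup>2" by auto
    moreover have "(z - y)\<^sup>2 = (z - 1)\<^sup>2 + 2 * ((z - 1) * (1 - y)) + (1 - y)\<^sup>2"
      "2 * (1 - y) * (z - y) = 2 * ((z - 1) * (1 - y)) + 2 * (1 - y)\<^sup>2"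
      by (simp_all add: power2_eq_square algebra_simps)
    moreover have "quad_hat z = 0" "quad_hat y = (1 - y)\<^sup>2" "max 0 (1 - y) = 1 - y"
      using \<open>\<not> z \<le> 1\<close> \<open>y \<le> 1\<close> by (auto simp: quad_hat_def)
    moreover have "\<bar>z - y\<bar>\<^sup>2 = (z - y)\<^sup>2" by simp
    ultimately show ?thesis by linarith
  next
    assume "z \<le> 1" "y \<le> 1"
    moreover have "(1 - z)\<^sup>2 - (1 - y)\<^sup>2 - - 2 * (1 - y) * (z - y) = (z - y)\<^sup>2"
      by (simp add: power2_eq_square algebra_simps)
    ultimately show ?thesis by (simp add: quad_hat_def)
  qed (simp add: quad_hat_def)
  show ?thesis
    unfolding has_field_derivative_def
  proof (rule has_derivativeI_sandwich[where e=1 and H="\<lambda>z. \<bar>z - y\<bar>"])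
    show "((\<lambda>z. \<bar>z - y\<bar>) \<longlongrightarrow> 0) (at y)"
      by (auto intro!: tendsto_eq_intros)
    show "bounded_linear ((*) (- 2 * max 0 (1 - y)))" by (rule bounded_linear_mult_right)
    fix z assume "z \<noteq> y"
    then show "norm (quad_hat z - quad_hat y - - 2 * max 0 (1 - y) * (z - y)) / norm (z - y) \<le> \<bar>z - y\<bar>"
      using taylor[of z] pos_divide_le_eq[of "\<bar>z - y\<bar>"]
      by (simp add: power2_eq_square)
  qed auto
qed

lemma has_C1_gradient_quad_hat:
  assumes "has_C1_gradient f f'"
  shows "has_C1_gradient (\<lambda>x. quad_hat (f x)) (\<lambda>x. (- 2 * max 0 (1 - f x)) *\<^sub>R f' x)"
  by (rule has_C1_gradient_compose_real[OF assms quad_hat_deriv]) (intro continuous_intros)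

lemma C1_bump_at_point:
  fixes c :: "'a::euclidean_space"
  assumes r: "r > 0"
  obtains h h' where "has_C1_gradient h h'" "\<And>x. 0 \<le> h x" "h c > 0"
    "\<And>x. r \<le> dist x c \<Longrightarrow> h x = 0 \<and> h' x = 0" "bounded (range h')"
proof
  let ?h = "\<lambda>x. quad_hat (1 / r\<^sup>2 * (dist x c)\<^sup>2)"
  let ?h' = "\<lambda>x. (- 2 * max 0 (1 - 1 / r\<^sup>2 * (dist x c)\<^sup>2)) *\<^sub>R ((1 / r\<^sup>2) *\<^sub>R (2 *\<^sub>R (x - c)))"
  show C1: "has_C1_gradient ?h ?h'"
    by (intro has_C1_gradient_quad_hat has_C1_gradient_cmult has_C1_gradient_dist_square)
  show zero: "?h x = 0 \<and> ?h' x = 0" if "r \<le> dist x c" for x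
  proof -
    have "r\<^sup>2 \<le> (dist x c)\<^sup>2" using that r by (intro power_mono) auto
    then show ?thesis using r by (simp add: quad_hat_def)
  qed
  show "0 \<le> ?h x" "?h c > 0" for x by (auto simp: quad_hat_def)
  have "compact (?h' ` cball c r)"
    using C1 by (intro compact_continuous_image)
      (auto simp: has_C1_gradient_def intro: continuous_on_subset)
  moreover have "range ?h' \<subseteq> insert 0 (?h' ` cball c r)"
  proof clarify
    fix x assume "?h' x \<notin> ?h' ` cball c r"
    then have "r \<le> dist x c" by (force simp: dist_commute)
    then show "?h' x = 0" using zero by blast
  qed
  ultimately show "bounded (range ?h')"
    by (meson bounded_insert bounded_subset compact_imp_bounded)
qed

text \<open>
  Around each point of \<open>A\<close> there is a bump that vanishes on \<open>B\<close>; by compactness, finitely many of them add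
  up to a function that is positive on all of \<open>A\<close>.
\<close>

lemma C1_positive_on_compact:
  fixes A B :: "'a::euclidean_space set"
  assumes A: "compact A" and B: "closed B" and disj: "A \<inter> B = {}"
  obtains s s' where "has_C1_gradient s s'" "\<And>x. 0 \<le> s x" "\<And>x. x \<in> A \<Longrightarrow> s x > 0"
    "\<And>x. x \<in> B \<Longrightarrow> s x = 0 \<and> s' x = 0" "bounded (range s')"
proof -
  have "\<exists>h h'. has_C1_gradient h h' \<and> (\<forall>x. 0 \<le> h x) \<and> h c > 0
      \<and> (\<forall>x\<in>B. h x = 0 \<and> h' x = 0) \<and> bounded (range h')" if c: "c \<in> A" for c
  proof -
    have "open (- B)" "c \<in> - B" using B c disj by auto
    then obtain r where r: "r > 0" "ball c r \<subseteq> - B" by (meson openE)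
    obtain h h' where h: "has_C1_gradient h h'" "\<And>x. 0 \<le> h x" "h c > 0"
      "\<And>x. r \<le> dist x c \<Longrightarrow> h x = 0 \<and> h' x = 0" "bounded (range h')"
      using C1_bump_at_point[OF r(1)] by metis
    have "r \<le> dist x c" if "x \<in> B" for x
      using r(2) that by (force simp: dist_commute not_less[symmetric])
    with h show ?thesis by (intro exI[of _ h] exI[of _ h'] conjI ballI allI) auto
  qed
  then obtain h h' where hh: "\<forall>c\<in>A. has_C1_gradient (h c) (h' c) \<and> (\<forall>x. 0 \<le> h c x) \<and> h c c > 0
      \<and> (\<forall>x\<in>B. h c x = 0 \<and> h' c x = 0) \<and> bounded (range (h' c))"
    by metis
  then have h: "\<And>c. c \<in> A \<Longrightarrow> has_C1_gradient (h c) (h' c)"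
      "\<And>c x. c \<in> A \<Longrightarrow> 0 \<le> h c x" "\<And>c. c \<in> A \<Longrightarrow> h c c > 0"
      "\<And>c x. c \<in> A \<Longrightarrow> x \<in> B \<Longrightarrow> h c x = 0 \<and> h' c x = 0"
      "\<And>c. c \<in> A \<Longrightarrow> bounded (range (h' c))"
    by auto
  have "open {x. h c x > 0}" if "c \<in> A" for c
    using has_C1_gradient_continuous[OF h(1)[OF that], of UNIV]
    by (intro open_Collect_less) auto
  moreover have "A \<subseteq> (\<Union>c\<in>A. {x. h c x > 0})" using h(3) by auto
  ultimately obtain P where P: "P \<subseteq> A" "finite P" "A \<subseteq> (\<Union>c\<in>P. {x. h c x > 0})"
    using compactE_image[OF A] by meson
  show ?thesis
  proof
    show "has_C1_gradient (\<lambda>x. \<Sum>c\<in>P. h c x) (\<lambda>x. \<Sum>c\<in>P. h' c x)"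
      using h(1) P(1) by (intro has_C1_gradient_sum) auto
    show "0 \<le> (\<Sum>c\<in>P. h c x)" for x
      using h(2) P(1) by (intro sum_nonneg) auto
    show "0 < (\<Sum>c\<in>P. h c x)" if x: "x \<in> A" for x
    proof -
      obtain c where "c \<in> P" "h c x > 0" using P(3) x by auto
      then show ?thesis using h(2) P by (intro sum_pos2[of P c]) auto
    qed
    show "(\<Sum>c\<in>P. h c x) = 0 \<and> (\<Sum>c\<in>P. h' c x) = 0" if "x \<in> B" for x
      using h(4) P(1) that by (metis (no_types, lifting) subsetD sum.neutral)
    have "\<forall>c\<in>P. \<exists>b. \<forall>x. norm (h' c x) \<le> b"
      using h(5) P(1) unfolding bounded_iff by blast
    then obtain b where "\<And>c x. c \<in> P \<Longrightarrow> norm (h' c x) \<le> b c" by metis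
    then have "norm (\<Sum>c\<in>P. h' c x) \<le> (\<Sum>c\<in>P. b c)" for x
      by (intro sum_norm_le) auto
    then show "bounded (range (\<lambda>x. \<Sum>c\<in>P. h' c x))"
      unfolding bounded_iff by blast
  qed
qed

text \<open>
  A Urysohn lemma with gradients.  If \<open>s\<close> is positive on \<open>A\<close> and zero on \<open>B\<close>, and \<open>m > 0\<close> is a lower bound of
  \<open>s\<close> on \<open>A\<close>, then \<open>1 - quad_hat (s / m)\<close> separates \<open>A\<close> from \<open>B\<close>.  Its gradient vanishes on \<open>A\<close> because
  \<open>quad_hat\<close> is flat from \<open>1\<close> on, and on \<open>B\<close> because the gradient of \<open>s\<close> does.
\<close>

lemma C1_Urysohn:
  fixes A B :: "'a::euclidean_space set"
  assumes A: "compact A" and B: "closed B" and disj: "A \<inter> B = {}"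
  obtains u u' where "has_C1_gradient u u'" "\<And>x. 0 \<le> u x \<and> u x \<le> 1"
    "\<And>x. x \<in> A \<Longrightarrow> u x = 1 \<and> u' x = 0" "\<And>x. x \<in> B \<Longrightarrow> u x = 0 \<and> u' x = 0"
    "bounded (range u')"
proof -
  obtain s s' where s: "has_C1_gradient s s'" "\<And>x. 0 \<le> s x" "\<And>x. x \<in> A \<Longrightarrow> s x > 0"
    "\<And>x. x \<in> B \<Longrightarrow> s x = 0 \<and> s' x = 0" "bounded (range s')"
    using C1_positive_on_compact[OF assms] by metis
  obtain m where m: "m > 0" "\<And>x. x \<in> A \<Longrightarrow> m \<le> s x"
  proof (cases "A = {}")
    case False
    then obtain z where "z \<in> A" "\<And>x. x \<in> A \<Longrightarrow> s z \<le> s x"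
      using continuous_attains_inf[OF A False has_C1_gradient_continuous[OF s(1)]] by blast
    then show ?thesis using that s(3) by blast
  qed (use that[of 1] in auto)
  let ?u = "\<lambda>x. 1 + - 1 * quad_hat (1 / m * s x)"
  let ?u' = "\<lambda>x. 0 + (- 1) *\<^sub>R ((- 2 * max 0 (1 - 1 / m * s x)) *\<^sub>R ((1 / m) *\<^sub>R s' x))"
  show ?thesis
  proof
    show "has_C1_gradient ?u ?u'"
      by (intro has_C1_gradient_add has_C1_gradient_const has_C1_gradient_cmult
          has_C1_gradient_quad_hat s)
    show "0 \<le> ?u x \<and> ?u x \<le> 1" for x
    proof -
      have "max 0 (1 - 1 / m * s x) \<le> 1" using s(2)[of x] m(1) by simp
      then have "quad_hat (1 / m * s x) \<le> 1"
        unfolding quad_hat_def by (intro power_le_one) auto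
      then show ?thesis by (simp add: quad_hat_def)
    qed
    show "?u x = 1 \<and> ?u' x = 0" if "x \<in> A" for x
      using m(1) m(2)[OF that] by (simp add: quad_hat_def)
    show "?u x = 0 \<and> ?u' x = 0" if "x \<in> B" for x
      using s(4)[OF that] by (simp add: quad_hat_def)
    obtain b where b: "\<And>x. norm (s' x) \<le> b" using s(5) unfolding bounded_iff by blast
    have "norm (?u' x) \<le> 2 / m * b" for x
    proof -
      have "max 0 (1 - 1 / m * s x) \<le> 1" using s(2)[of x] m(1) by simp
      then have "max 0 (1 - 1 / m * s x) * (1 / m * norm (s' x)) \<le> 1 * (1 / m * b)"
        using b[of x] m(1) by (intro mult_mono) (auto simp: divide_right_mono)
      then show ?thesis using m(1) by (simp add: abs_mult)
    qed
    then show "bounded (range ?u')" unfolding bounded_iff by blast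
  qed
qed

section \<open>A gluing operator and the limit of its iterates\<close>

text \<open>
  Cutoff functions with disjoint supports do not add up: this is why the factors \<open>p\<^sub>i / \<rho>\<^sub>i\<close>, whose sum may be
  large, enter the estimates below only through their maximum.
\<close>

lemma norm_sum_single_le:
  fixes v :: "'i \<Rightarrow> 'b::real_normed_vector"
  assumes "finite I" and single: "\<And>i j. i \<in> I \<Longrightarrow> j \<in> I \<Longrightarrow> i \<noteq> j \<Longrightarrow> v i = 0 \<or> v j = 0"
    and le: "\<And>i. i \<in> I \<Longrightarrow> norm (v i) \<le> b" and "0 \<le> b"
  shows "norm (\<Sum>i\<in>I. v i) \<le> b"
proof (cases "\<exists>i\<in>I. v i \<noteq> 0")
  case True
  then obtain i where i: "i \<in> I" "v i \<noteq> 0" by blast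
  then have "(\<Sum>j\<in>I - {i}. v j) = 0"
    by (intro sum.neutral) (use single in blast)
  then have "(\<Sum>j\<in>I. v j) = v i"
    using sum.remove[OF \<open>finite I\<close> i(1), of v] by simp
  then show ?thesis using le i(1) by simp
next
  case False
  then show ?thesis using \<open>0 \<le> b\<close> by simp
qed

text \<open>
  The analytic data of the gluing.  The index \<open>i\<close> stands for the piece \<open>\<phi>\<^sub>i(K)\<close> of a zipper whose first and last
  pieces are \<open>S0\<close> and \<open>S1\<close>; \<open>\<psi> i\<close> is the inverse of \<open>\<phi>\<^sub>i\<close>, and \<open>R i\<close>, the adjoint of the linear part of
  \<open>\<psi> i\<close>, turns the gradient of \<open>f\<close> into the gradient of \<open>f \<circ> \<psi> i\<close>.  The values \<open>-1\<close> and \<open>1\<close> at the two ends are chosen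
  so that a reversed orientation of \<open>\<phi>\<^sub>i(K)\<close> amounts to the sign \<open>\<epsilon> i = -1\<close>.

  The last assumption lists the three situations at a point of \<open>K\<close>.  It lies in another piece, where the
  summand for \<open>i\<close> has gradient zero.  Or it lies in the image of an inner piece, where only \<open>f \<circ> \<psi> i\<close> counts.
  Or it lies in the image of \<open>S0\<close> or \<open>S1\<close>; there \<open>\<kappa> i\<close> is arbitrary, but it blends two functions that agree.
\<close>

locale gluing_operator =
  fixes K S0 S1 :: "'a::euclidean_space set" and I :: "'i set"
    and p \<epsilon> \<rho> :: "'i \<Rightarrow> real" and q C :: real
    and \<psi> R :: "'i \<Rightarrow> 'a \<Rightarrow> 'a"
    and \<kappa> u :: "'i \<Rightarrow> 'a \<Rightarrow> real" and \<kappa>' u' :: "'i \<Rightarrow> 'a \<Rightarrow> 'a"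
  assumes finite_I: "finite I" and I_nonempty: "I \<noteq> {}"
    and sum_p: "sum p I = 1" and p_nonneg: "\<And>i. i \<in> I \<Longrightarrow> 0 \<le> p i"
    and p_le: "\<And>i. i \<in> I \<Longrightarrow> p i \<le> q * \<rho> i"
    and \<rho>: "\<And>i. i \<in> I \<Longrightarrow> 0 < \<rho> i" "\<And>i. i \<in> I \<Longrightarrow> \<rho> i \<le> 1" and q1: "q < 1"
    and \<epsilon>: "\<And>i. i \<in> I \<Longrightarrow> \<bar>\<epsilon> i\<bar> = 1"
    and pullback: "\<And>i f g. i \<in> I \<Longrightarrow> has_C1_gradient f g \<Longrightarrow>
        has_C1_gradient (\<lambda>x. f (\<psi> i x)) (\<lambda>x. R i (g (\<psi> i x)))"
    and R_norm: "\<And>i v. i \<in> I \<Longrightarrow> norm (R i v) \<le> norm v / \<rho> i"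
    and R_diff: "\<And>i v w. i \<in> I \<Longrightarrow> R i (v - w) = R i v - R i w"
    and \<kappa>: "\<And>i. i \<in> I \<Longrightarrow> has_C1_gradient (\<kappa> i) (\<kappa>' i)"
      "\<And>i x. i \<in> I \<Longrightarrow> 0 \<le> \<kappa> i x \<and> \<kappa> i x \<le> 1"
      "\<And>i x. i \<in> I \<Longrightarrow> norm (\<kappa>' i x) \<le> C"
    and \<kappa>_single: "\<And>i j x. i \<in> I \<Longrightarrow> j \<in> I \<Longrightarrow> i \<noteq> j \<Longrightarrow>
        (\<kappa> i x = 0 \<and> \<kappa>' i x = 0) \<or> (\<kappa> j x = 0 \<and> \<kappa>' j x = 0)"
    and u: "\<And>i. i \<in> I \<Longrightarrow> has_C1_gradient (u i) (u' i)"
      "\<And>i x. i \<in> I \<Longrightarrow> \<bar>u i x\<bar> \<le> 1"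
      "\<And>i x. i \<in> I \<Longrightarrow> norm (u' i x) \<le> C"
    and S: "S0 \<noteq> {}" "S0 \<inter> S1 = {}" "compact S0" "compact S1"
    and on_S0: "\<And>i x. i \<in> I \<Longrightarrow> x \<in> S0 \<Longrightarrow> \<kappa> i x = 0 \<and> u i x = -1"
    and on_S1: "\<And>i x. i \<in> I \<Longrightarrow> x \<in> S1 \<Longrightarrow> \<kappa> i x = 0 \<and> u i x = 1"
    and on_K: "\<And>i x. i \<in> I \<Longrightarrow> x \<in> K \<Longrightarrow>
        (\<kappa> i x = 0 \<and> \<kappa>' i x = 0 \<and> u' i x = 0) \<or>
        (\<psi> i x \<in> K \<and>
          (\<kappa> i x = 1 \<and> \<kappa>' i x = 0 \<or>
           u' i x = 0 \<and> (\<psi> i x \<in> S0 \<and> u i x = - \<epsilon> i \<or> \<psi> i x \<in> S1 \<and> u i x = \<epsilon> i)))"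
begin

lemma C_nonneg: "0 \<le> C"
  using I_nonempty u(3) norm_ge_zero order_trans by (metis all_not_in_conv)

lemma q_nonneg: "0 \<le> q"
proof -
  obtain i where i: "i \<in> I" using I_nonempty by blast
  then have "0 \<le> q * \<rho> i" using p_le p_nonneg by (meson order_trans)
  then show ?thesis using \<rho>(1)[OF i] by (simp add: zero_le_mult_iff)
qed

lemma p_le_q: "i \<in> I \<Longrightarrow> p i \<le> q"
  using p_le[of i] mult_left_mono[OF \<rho>(2)[of i] q_nonneg] by simp

lemma abs_\<epsilon>: "i \<in> I \<Longrightarrow> \<bar>\<epsilon> i * y\<bar> = \<bar>y\<bar>"
  by (simp add: abs_mult \<epsilon>)

lemma p_R_norm: "i \<in> I \<Longrightarrow> p i * norm (R i v) \<le> q * norm v"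
proof -
  assume i: "i \<in> I"
  have "p i * norm (R i v) \<le> (q * \<rho> i) * (norm v / \<rho> i)"
    using p_le[OF i] R_norm[OF i, of v] p_nonneg[OF i] q_nonneg \<rho>(1)[OF i] by (intro mult_mono) auto
  then show ?thesis using \<rho>(1)[OF i] by simp
qed

lemma convex_combination_le:
  assumes "\<And>i. i \<in> I \<Longrightarrow> norm (v i) \<le> b"
  shows "norm (\<Sum>i\<in>I. p i *\<^sub>R v i) \<le> b"
proof -
  have "norm (\<Sum>i\<in>I. p i *\<^sub>R v i) \<le> (\<Sum>i\<in>I. p i * b)"
    by (rule sum_norm_le) (use assms p_nonneg in \<open>auto intro!: mult_left_mono\<close>)
  then show ?thesis by (simp add: sum_distrib_right[symmetric] sum_p)
qed

definition T :: "('a \<Rightarrow> real) \<Rightarrow> 'a \<Rightarrow> real" where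
  "T f x = (\<Sum>i\<in>I. p i * (\<kappa> i x * (\<epsilon> i * f (\<psi> i x)) + (1 - \<kappa> i x) * u i x))"

text \<open>
  This is the gradient of \<open>T f\<close> if \<open>g\<close> is the gradient of \<open>f\<close>.
\<close>

definition T' :: "('a \<Rightarrow> real) \<Rightarrow> ('a \<Rightarrow> 'a) \<Rightarrow> 'a \<Rightarrow> 'a" where
  "T' f g x = (\<Sum>i\<in>I. p i *\<^sub>R ((\<kappa> i x * \<epsilon> i) *\<^sub>R R i (g (\<psi> i x))
      + (\<epsilon> i * f (\<psi> i x) - u i x) *\<^sub>R \<kappa>' i x + (1 - \<kappa> i x) *\<^sub>R u' i x))"

lemma T_C1:
  assumes "has_C1_gradient f g"
  shows "has_C1_gradient (T f) (T' f g)"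
proof -
  have "has_C1_gradient (\<lambda>x. p i * (\<kappa> i x * (\<epsilon> i * f (\<psi> i x)) + (1 - \<kappa> i x) * u i x))
     (\<lambda>x. p i *\<^sub>R ((\<kappa> i x * \<epsilon> i) *\<^sub>R R i (g (\<psi> i x))
      + (\<epsilon> i * f (\<psi> i x) - u i x) *\<^sub>R \<kappa>' i x + (1 - \<kappa> i x) *\<^sub>R u' i x))" if i: "i \<in> I" for i
  proof -
    have "has_C1_gradient (\<lambda>x. p i * (\<kappa> i x * (\<epsilon> i * f (\<psi> i x)) + (1 + - 1 * \<kappa> i x) * u i x))
      (\<lambda>x. p i *\<^sub>R ((\<kappa> i x *\<^sub>R (\<epsilon> i *\<^sub>R R i (g (\<psi> i x))) + (\<epsilon> i * f (\<psi> i x)) *\<^sub>R \<kappa>' i x)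
        + ((1 + - 1 * \<kappa> i x) *\<^sub>R u' i x + u i x *\<^sub>R (0 + (- 1) *\<^sub>R \<kappa>' i x))))"
      by (intro has_C1_gradient_cmult has_C1_gradient_add has_C1_gradient_mult
          has_C1_gradient_const pullback assms \<kappa>(1) u(1) i)
    then show ?thesis by (simp add: algebra_simps)
  qed
  then show ?thesis
    unfolding T_def[abs_def] T'_def[abs_def] by (rule has_C1_gradient_sum)
qed

lemma T_bound:
  assumes "\<And>x. \<bar>f x\<bar> \<le> 1"
  shows "\<bar>T f x\<bar> \<le> 1"
proof -
  have "\<bar>\<kappa> i x * (\<epsilon> i * f (\<psi> i x)) + (1 - \<kappa> i x) * u i x\<bar> \<le> 1" if i: "i \<in> I" for i
  proof -
    have "\<bar>\<kappa> i x * (\<epsilon> i * f (\<psi> i x))\<bar> \<le> \<kappa> i x * 1"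
      unfolding abs_mult[of "\<kappa> i x"] abs_\<epsilon>[OF i]
      using \<kappa>(2)[OF i, of x] assms[of "\<psi> i x"] by (intro mult_mono) auto
    moreover have "\<bar>(1 - \<kappa> i x) * u i x\<bar> \<le> (1 - \<kappa> i x) * 1"
      unfolding abs_mult using \<kappa>(2)[OF i, of x] u(2)[OF i, of x] by (intro mult_mono) auto
    ultimately have "\<bar>\<kappa> i x * (\<epsilon> i * f (\<psi> i x))\<bar> + \<bar>(1 - \<kappa> i x) * u i x\<bar>
        \<le> \<kappa> i x * 1 + (1 - \<kappa> i x) * 1"
      by (rule add_mono)
    then show ?thesis by (intro order_trans[OF abs_triangle_ineq]) simp
  qed
  then show ?thesis
    using convex_combination_le[of "\<lambda>i. \<kappa> i x * (\<epsilon> i * f (\<psi> i x)) + (1 - \<kappa> i x) * u i x" 1]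
    by (simp add: T_def)
qed

lemma T_S0: "x \<in> S0 \<Longrightarrow> T f x = - 1"
  using on_S0 sum_p by (simp add: T_def sum_negf)

lemma T_S1: "x \<in> S1 \<Longrightarrow> T f x = 1"
  using on_S1 sum_p by (simp add: T_def)

lemma T'_bound:
  assumes f: "\<And>x. \<bar>f x\<bar> \<le> 1" and g: "\<And>x. norm (g x) \<le> b"
  shows "norm (T' f g x) \<le> q * b + 3 * C"
proof -
  have b: "0 \<le> b" using g norm_ge_zero order_trans by metis
  have A: "norm (\<Sum>i\<in>I. p i *\<^sub>R ((\<kappa> i x * \<epsilon> i) *\<^sub>R R i (g (\<psi> i x)))) \<le> q * b"
  proof (rule norm_sum_single_le[OF finite_I])
    fix i assume i: "i \<in> I"
    have "norm (p i *\<^sub>R ((\<kappa> i x * \<epsilon> i) *\<^sub>R R i (g (\<psi> i x)))) = \<kappa> i x * (p i * norm (R i (g (\<psi> i x))))"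
      using p_nonneg[OF i] \<kappa>(2)[OF i, of x] \<epsilon>[OF i] by (simp add: abs_mult)
    also have "\<dots> \<le> 1 * (q * b)"
    proof (rule mult_mono)
      show "p i * norm (R i (g (\<psi> i x))) \<le> q * b"
        using p_R_norm[OF i, of "g (\<psi> i x)"] mult_left_mono[OF g[of "\<psi> i x"] q_nonneg] by linarith
    qed (use \<kappa>(2)[OF i, of x] p_nonneg[OF i] in auto)
    finally show "norm (p i *\<^sub>R ((\<kappa> i x * \<epsilon> i) *\<^sub>R R i (g (\<psi> i x)))) \<le> q * b" by simp
  next
    fix i j assume "i \<in> I" "j \<in> I" "i \<noteq> j"
    then show "p i *\<^sub>R ((\<kappa> i x * \<epsilon> i) *\<^sub>R R i (g (\<psi> i x))) = 0 \<or> p j *\<^sub>R ((\<kappa> j x * \<epsilon> j) *\<^sub>R R j (g (\<psi> j x))) = 0"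
      using \<kappa>_single[of i j x] by auto
  qed (use b q_nonneg in simp)
  have B: "norm (\<Sum>i\<in>I. p i *\<^sub>R ((\<epsilon> i * f (\<psi> i x) - u i x) *\<^sub>R \<kappa>' i x + (1 - \<kappa> i x) *\<^sub>R u' i x)) \<le> 3 * C"
  proof (rule convex_combination_le)
    fix i assume i: "i \<in> I"
    have "\<bar>\<epsilon> i * f (\<psi> i x) - u i x\<bar> \<le> 2"
      using abs_\<epsilon>[OF i, of "f (\<psi> i x)"] f[of "\<psi> i x"] u(2)[OF i, of x] by linarith
    then have "\<bar>\<epsilon> i * f (\<psi> i x) - u i x\<bar> * norm (\<kappa>' i x) \<le> 2 * C"
      using \<kappa>(3)[OF i, of x] by (intro mult_mono) auto
    moreover have "\<bar>1 - \<kappa> i x\<bar> * norm (u' i x) \<le> 1 * C"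
      using \<kappa>(2)[OF i, of x] u(3)[OF i, of x] by (intro mult_mono) auto
    ultimately show "norm ((\<epsilon> i * f (\<psi> i x) - u i x) *\<^sub>R \<kappa>' i x + (1 - \<kappa> i x) *\<^sub>R u' i x) \<le> 3 * C"
      by (intro order_trans[OF norm_triangle_ineq]) simp
  qed
  have "T' f g x = (\<Sum>i\<in>I. p i *\<^sub>R ((\<kappa> i x * \<epsilon> i) *\<^sub>R R i (g (\<psi> i x))))
      + (\<Sum>i\<in>I. p i *\<^sub>R ((\<epsilon> i * f (\<psi> i x) - u i x) *\<^sub>R \<kappa>' i x + (1 - \<kappa> i x) *\<^sub>R u' i x))"
    by (simp add: T'_def sum.distrib[symmetric] scaleR_add_right add.assoc)
  with A B show ?thesis by (smt (verit) norm_triangle_ineq)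
qed

lemma T_contract:
  assumes d: "\<And>x. \<bar>f x - h x\<bar> \<le> \<alpha>"
  shows "\<bar>T f x - T h x\<bar> \<le> q * \<alpha>"
proof -
  have \<alpha>: "0 \<le> \<alpha>" using d abs_ge_zero order_trans by metis
  have "T f x - T h x = (\<Sum>i\<in>I. p i * (\<kappa> i x * (\<epsilon> i * (f (\<psi> i x) - h (\<psi> i x)))))"
    by (simp add: T_def sum_subtractf[symmetric] algebra_simps)
  also have "norm \<dots> \<le> q * \<alpha>"
  proof (rule norm_sum_single_le[OF finite_I])
    fix i assume i: "i \<in> I"
    have "norm (p i * (\<kappa> i x * (\<epsilon> i * (f (\<psi> i x) - h (\<psi> i x))))) = p i * (\<kappa> i x * \<bar>f (\<psi> i x) - h (\<psi> i x)\<bar>)"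
      using p_nonneg[OF i] \<kappa>(2)[OF i, of x] \<epsilon>[OF i] by (simp add: abs_mult)
    also have "\<dots> \<le> q * (1 * \<alpha>)"
      using p_le_q[OF i] d[of "\<psi> i x"] \<kappa>(2)[OF i, of x] p_nonneg[OF i] q_nonneg \<alpha>
      by (intro mult_mono mult_nonneg_nonneg) auto
    finally show "norm (p i * (\<kappa> i x * (\<epsilon> i * (f (\<psi> i x) - h (\<psi> i x))))) \<le> q * \<alpha>" by simp
  next
    fix i j assume "i \<in> I" "j \<in> I" "i \<noteq> j"
    then show "p i * (\<kappa> i x * (\<epsilon> i * (f (\<psi> i x) - h (\<psi> i x)))) = 0 \<or>
        p j * (\<kappa> j x * (\<epsilon> j * (f (\<psi> j x) - h (\<psi> j x)))) = 0"
      using \<kappa>_single[of i j x] by auto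
  qed (use \<alpha> q_nonneg in simp)
  finally show ?thesis by simp
qed

text \<open>
  The gradient of \<open>f \<circ> \<psi> i\<close> is at most \<open>1 / \<rho> i\<close> times that of \<open>f\<close>, and the weight \<open>p i \<le> q * \<rho> i\<close> more than makes
  up for it.  The second term is the price for differentiating the cutoff function; the step functions
  cancel in the difference.
\<close>

lemma T'_contract:
  assumes f: "\<And>x. \<bar>f x - h x\<bar> \<le> \<alpha>" and g: "\<And>x. norm (g x - k x) \<le> \<beta>"
  shows "norm (T' f g x - T' h k x) \<le> q * \<beta> + C * \<alpha>"
proof -
  have \<alpha>: "0 \<le> \<alpha>" using f abs_ge_zero order_trans by metis
  have \<beta>: "0 \<le> \<beta>" using g norm_ge_zero order_trans by metis
  have "T' f g x - T' h k x = (\<Sum>i\<in>I. p i *\<^sub>R ((\<kappa> i x * \<epsilon> i) *\<^sub>R R i (g (\<psi> i x) - k (\<psi> i x))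
      + (\<epsilon> i * (f (\<psi> i x) - h (\<psi> i x))) *\<^sub>R \<kappa>' i x))"
    unfolding T'_def sum_subtractf[symmetric]
    by (intro sum.cong refl) (simp add: R_diff algebra_simps)
  also have "norm \<dots> \<le> q * \<beta> + C * \<alpha>"
  proof (rule norm_sum_single_le[OF finite_I])
    fix i assume i: "i \<in> I"
    have "norm ((\<kappa> i x * \<epsilon> i) *\<^sub>R R i (g (\<psi> i x) - k (\<psi> i x))) \<le> norm (R i (g (\<psi> i x) - k (\<psi> i x)))"
      using \<kappa>(2)[OF i, of x] \<epsilon>[OF i] by (simp add: abs_mult mult_left_le_one_le)
    then have "p i * norm ((\<kappa> i x * \<epsilon> i) *\<^sub>R R i (g (\<psi> i x) - k (\<psi> i x))) \<le> q * \<beta>"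
      using p_R_norm[OF i, of "g (\<psi> i x) - k (\<psi> i x)"] mult_left_mono[OF g[of "\<psi> i x"] q_nonneg]
        mult_left_mono[OF _ p_nonneg[OF i]] order_trans by meson
    moreover have "p i * norm ((\<epsilon> i * (f (\<psi> i x) - h (\<psi> i x))) *\<^sub>R \<kappa>' i x) \<le> 1 * (\<alpha> * C)"
      using p_le_q[OF i] p_nonneg[OF i] q1 f[of "\<psi> i x"] \<kappa>(3)[OF i, of x] \<alpha> abs_\<epsilon>[OF i]
      by (simp only: norm_scaleR) (intro mult_mono mult_nonneg_nonneg; simp)
    ultimately have "p i * (norm ((\<kappa> i x * \<epsilon> i) *\<^sub>R R i (g (\<psi> i x) - k (\<psi> i x)))
      + norm ((\<epsilon> i * (f (\<psi> i x) - h (\<psi> i x))) *\<^sub>R \<kappa>' i x)) \<le> q * \<beta> + C * \<alpha>"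
      by (simp add: distrib_left mult.commute)
    then show "norm (p i *\<^sub>R ((\<kappa> i x * \<epsilon> i) *\<^sub>R R i (g (\<psi> i x) - k (\<psi> i x))
      + (\<epsilon> i * (f (\<psi> i x) - h (\<psi> i x))) *\<^sub>R \<kappa>' i x)) \<le> q * \<beta> + C * \<alpha>"
      using mult_left_mono[OF norm_triangle_ineq p_nonneg[OF i]] p_nonneg[OF i] order_trans
      by (metis (no_types, lifting) abs_of_nonneg norm_scaleR)
  next
    fix i j assume "i \<in> I" "j \<in> I" "i \<noteq> j"
    then show "p i *\<^sub>R ((\<kappa> i x * \<epsilon> i) *\<^sub>R R i (g (\<psi> i x) - k (\<psi> i x))
        + (\<epsilon> i * (f (\<psi> i x) - h (\<psi> i x))) *\<^sub>R \<kappa>' i x) = 0 \<or>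
      p j *\<^sub>R ((\<kappa> j x * \<epsilon> j) *\<^sub>R R j (g (\<psi> j x) - k (\<psi> j x))
        + (\<epsilon> j * (f (\<psi> j x) - h (\<psi> j x))) *\<^sub>R \<kappa>' j x) = 0"
      using \<kappa>_single[of i j x] by auto
  qed (use \<alpha> \<beta> q_nonneg C_nonneg in simp)
  finally show ?thesis .
qed


text \<open>
  On \<open>K\<close> the terms with \<open>\<kappa>'\<close> and \<open>u'\<close> disappear: either the derivative is zero, or its coefficient is the difference
  of two functions that agree at the point.  So the estimate has no contribution from the cutoff functions,
  in contrast to \<open>T'_bound\<close>.
\<close>

lemma T'_on_K:
  assumes x: "x \<in> K" and b: "0 \<le> b" and g: "\<And>y. y \<in> K \<Longrightarrow> norm (g y) \<le> b"
    and f: "\<And>y. y \<in> S0 \<Longrightarrow> f y = - 1" "\<And>y. y \<in> S1 \<Longrightarrow> f y = 1"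
  shows "norm (T' f g x) \<le> q * b"
proof -
  let ?v = "\<lambda>i. p i *\<^sub>R ((\<kappa> i x * \<epsilon> i) *\<^sub>R R i (g (\<psi> i x)))"
  have "T' f g x = (\<Sum>i\<in>I. ?v i)"
    unfolding T'_def
  proof (intro sum.cong refl arg_cong[where f="\<lambda>v. p _ *\<^sub>R v"])
    fix i assume i: "i \<in> I"
    have "(\<epsilon> i * f (\<psi> i x) - u i x) *\<^sub>R \<kappa>' i x + (1 - \<kappa> i x) *\<^sub>R u' i x = 0"
      using on_K[OF i x] f by auto
    then show "(\<kappa> i x * \<epsilon> i) *\<^sub>R R i (g (\<psi> i x)) + (\<epsilon> i * f (\<psi> i x) - u i x) *\<^sub>R \<kappa>' i x
        + (1 - \<kappa> i x) *\<^sub>R u' i x = (\<kappa> i x * \<epsilon> i) *\<^sub>R R i (g (\<psi> i x))"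
      by (simp add: add.assoc)
  qed
  also have "norm \<dots> \<le> q * b"
  proof (rule norm_sum_single_le[OF finite_I])
    fix i assume i: "i \<in> I"
    show "norm (?v i) \<le> q * b"
    proof (cases "\<psi> i x \<in> K")
      case True
      have "norm (?v i) = \<kappa> i x * (p i * norm (R i (g (\<psi> i x))))"
        using p_nonneg[OF i] \<kappa>(2)[OF i, of x] \<epsilon>[OF i] by (simp add: abs_mult)
      also have "\<dots> \<le> 1 * (q * b)"
      proof (rule mult_mono)
        show "p i * norm (R i (g (\<psi> i x))) \<le> q * b"
          using p_R_norm[OF i, of "g (\<psi> i x)"] mult_left_mono[OF g[OF True] q_nonneg] by linarith
      qed (use \<kappa>(2)[OF i, of x] p_nonneg[OF i] in auto)
      finally show ?thesis by simp
    next
      case False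
      then show ?thesis using on_K[OF i x] b q_nonneg by auto
    qed
  next
    fix i j assume "i \<in> I" "j \<in> I" "i \<noteq> j"
    then show "?v i = 0 \<or> ?v j = 0" using \<kappa>_single[of i j x] by auto
  qed (use b q_nonneg in simp)
  finally show ?thesis .
qed

text \<open>
  The suprema of the differences of consecutive iterates decrease like \<open>q ^ k\<close>; feeding this into the estimate
  for the gradients makes these decrease like \<open>r ^ k\<close> for any \<open>r\<close> between \<open>q\<close> and \<open>1\<close>, so the gradients converge
  uniformly.  The functions themselves then converge because they do so at one point of \<open>S0\<close>.
\<close>

lemma exists_glued_limit:
  obtains F G where "has_C1_gradient F G" "\<And>x. x \<in> S0 \<Longrightarrow> F x = - 1" "\<And>x. x \<in> S1 \<Longrightarrow> F x = 1"
    "\<And>x. x \<in> K \<Longrightarrow> G x = 0"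
proof -
  obtain h h' where h: "has_C1_gradient h h'" "\<And>x. 0 \<le> h x \<and> h x \<le> 1"
    "\<And>x. x \<in> S1 \<Longrightarrow> h x = 1 \<and> h' x = 0" "\<And>x. x \<in> S0 \<Longrightarrow> h x = 0 \<and> h' x = 0"
    "bounded (range h')"
    using C1_Urysohn[of S1 S0] S compact_imp_closed by (metis inf_commute)
  define f0 where "f0 = (\<lambda>x. - 1 + 2 * h x)"
  define g0 where "g0 = (\<lambda>x. 0 + 2 *\<^sub>R h' x)"
  have fg0: "has_C1_gradient f0 g0"
    unfolding f0_def g0_def by (intro has_C1_gradient_add has_C1_gradient_const has_C1_gradient_cmult h)
  have f0: "\<bar>f0 x\<bar> \<le> 1" for x using h(2)[of x] by (simp add: f0_def abs_le_iff)
  obtain b where b: "norm (h' x) \<le> b" for x using h(5) unfolding bounded_iff by blast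
  have b_nonneg: "0 \<le> b" by (rule order_trans[OF norm_ge_zero b])
  have g0: "norm (g0 x) \<le> 2 * b" for x using b[of x] by (simp add: g0_def)
  define step where "step = (\<lambda>(f, g). (T f, T' f g))"
  define f where "f k = fst ((step ^^ k) (f0, g0))" for k
  define g where "g k = snd ((step ^^ k) (f0, g0))" for k
  have f_0: "f 0 = f0" and g_0: "g 0 = g0" by (simp_all add: f_def g_def)
  have f_Suc: "f (Suc k) = T (f k)" and g_Suc: "g (Suc k) = T' (f k) (g k)" for k
    by (simp_all add: f_def g_def step_def case_prod_beta)
  have C1: "has_C1_gradient (f k) (g k)" for k
    by (induction k) (simp_all add: f_0 g_0 fg0 f_Suc g_Suc T_C1)
  have f_S0: "f k x = - 1" if "x \<in> S0" for k x
    using that h(4) by (cases k) (simp_all add: f_0 f0_def f_Suc T_S0)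
  have f_S1: "f k x = 1" if "x \<in> S1" for k x
    using that h(3) by (cases k) (simp_all add: f_0 f0_def f_Suc T_S1)
  define r where "r = (1 + q) / 2"
  have r: "0 < r" "r < 1" "q < r" using q1 q_nonneg by (auto simp: r_def)
  define \<alpha> where "\<alpha> = (2::real)"
  \<comment> \<open>The second argument of the maximum makes \<open>q * \<beta> + C * \<alpha> \<le> r * \<beta>\<close>, the first one starts the induction.\<close>
  define \<beta> where "\<beta> = max (q * (2 * b) + 3 * C + 2 * b) (C * \<alpha> / (r - q))"
  have \<beta>: "q * \<beta> + C * \<alpha> \<le> r * \<beta>"
  proof -
    have "C * \<alpha> / (r - q) \<le> \<beta>" by (simp add: \<beta>_def)
    then show ?thesis using r(3) by (simp add: pos_divide_le_eq algebra_simps)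
  qed
  have diff: "(\<forall>x. \<bar>f (Suc k) x - f k x\<bar> \<le> r ^ k * \<alpha>) \<and> (\<forall>x. norm (g (Suc k) x - g k x) \<le> r ^ k * \<beta>)" for k
  proof (induction k)
    case 0
    have "\<bar>T f0 x - f0 x\<bar> \<le> 2" for x
      using T_bound[of f0 x, OF f0] f0[of x] by linarith
    moreover have "norm (T' f0 g0 x - g0 x) \<le> \<beta>" for x
    proof -
      have "norm (T' f0 g0 x - g0 x) \<le> (q * (2 * b) + 3 * C) + 2 * b"
        using T'_bound[of f0 g0 "2 * b" x] f0 g0 norm_triangle_ineq4[of "T' f0 g0 x" "g0 x"]
        by (meson add_mono order_trans)
      then show ?thesis by (simp add: \<beta>_def)
    qed
    ultimately show ?case by (simp add: f_0 g_0 f_Suc g_Suc \<alpha>_def)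
  next
    case (Suc k)
    have "\<bar>T (f (Suc k)) x - T (f k) x\<bar> \<le> r ^ Suc k * \<alpha>" for x
    proof -
      have "\<bar>T (f (Suc k)) x - T (f k) x\<bar> \<le> q * (r ^ k * \<alpha>)"
        using Suc by (intro T_contract) auto
      also have "\<dots> \<le> r * (r ^ k * \<alpha>)"
        using r by (intro mult_right_mono) (auto simp: \<alpha>_def)
      finally show ?thesis by (simp add: mult.assoc)
    qed
    moreover have "norm (T' (f (Suc k)) (g (Suc k)) x - T' (f k) (g k) x) \<le> r ^ Suc k * \<beta>" for x
    proof -
      have "norm (T' (f (Suc k)) (g (Suc k)) x - T' (f k) (g k) x) \<le> q * (r ^ k * \<beta>) + C * (r ^ k * \<alpha>)"
        using Suc by (intro T'_contract) auto
      also have "\<dots> = r ^ k * (q * \<beta> + C * \<alpha>)" by (simp add: algebra_simps)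
      also have "\<dots> \<le> r ^ k * (r * \<beta>)" using \<beta> r by (intro mult_left_mono) auto
      finally show ?thesis by (simp add: algebra_simps)
    qed
    ultimately show ?case by (simp add: f_Suc[of "Suc k"] g_Suc[of "Suc k"] f_Suc[of k, symmetric] g_Suc[of k, symmetric] del: power_Suc)
  qed
  define G where "G x = g 0 x + (\<Sum>k. g (Suc k) x - g k x)" for x
  have "uniform_limit UNIV (\<lambda>n x. \<Sum>k<n. g (Suc k) x - g k x) (\<lambda>x. \<Sum>k. g (Suc k) x - g k x) sequentially"
  proof (rule Weierstrass_m_test)
    show "norm (g (Suc k) x - g k x) \<le> r ^ k * \<beta>" for k x using diff by blast
    show "summable (\<lambda>k. r ^ k * \<beta>)"
      using r by (intro summable_mult2 summable_geometric) auto
  qed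
  moreover have "(\<Sum>k<n. g (Suc k) x - g k x) = g n x - g 0 x" for n x
    by (rule sum_lessThan_telescope)
  ultimately have lim: "uniform_limit UNIV g G sequentially"
    by (simp add: uniform_limit_iff dist_norm G_def algebra_simps)
  have G_cont: "continuous_on UNIV G"
    using C1 by (intro uniform_limit_theorem[OF _ lim] always_eventually)
      (auto simp: has_C1_gradient_def)
  obtain z where z: "z \<in> S0" using S(1) by blast
  have "\<exists>F. \<forall>x\<in>UNIV. (\<lambda>n. f n x) \<longlonglongrightarrow> F x \<and> (F has_derivative (\<lambda>v. v \<bullet> G x)) (at x within UNIV)"
  proof (rule has_derivative_sequence)
    show "(f n has_derivative (\<lambda>v. v \<bullet> g n x)) (at x within UNIV)" for n x
      using C1[of n] by (simp add: has_C1_gradient_def gderiv_def)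
    show "(\<lambda>n. f n z) \<longlonglongrightarrow> - 1" using f_S0[OF z] by simp
    fix e :: real assume "e > 0"
    then have "\<forall>\<^sub>F n in sequentially. \<forall>x\<in>UNIV. dist (g n x) (G x) < e"
      using lim by (simp add: uniform_limit_iff)
    then show "\<forall>\<^sub>F n in sequentially. \<forall>x\<in>UNIV. \<forall>v. norm (v \<bullet> g n x - v \<bullet> G x) \<le> e * norm v"
    proof (eventually_elim, intro ballI allI)
      fix n x and v :: 'a assume "\<forall>x\<in>UNIV. dist (g n x) (G x) < e"
      then have "norm (g n x - G x) \<le> e" by (simp add: dist_norm less_imp_le)
      then have "norm v * norm (g n x - G x) \<le> norm v * e" by (intro mult_left_mono) auto
      then show "norm (v \<bullet> g n x - v \<bullet> G x) \<le> e * norm v"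
        using Cauchy_Schwarz_ineq2[of v "g n x - G x"] by (simp add: inner_diff_right mult.commute)
    qed
  qed auto
  then obtain F where F: "\<And>x. (\<lambda>n. f n x) \<longlonglongrightarrow> F x" "\<And>x. GDERIV F x :> G x"
    by (auto simp: gderiv_def)
  show thesis
  proof
    show "has_C1_gradient F G" using F(2) G_cont by (simp add: has_C1_gradient_def)
    show "F x = - 1" if "x \<in> S0" for x
      using F(1)[of x] f_S0[OF that] by (simp add: LIMSEQ_const_iff)
    show "F x = 1" if "x \<in> S1" for x
      using F(1)[of x] f_S1[OF that] by (simp add: LIMSEQ_const_iff)
    show "G x = 0" if x: "x \<in> K" for x
    proof -
      have "(\<lambda>n. q ^ n * (2 * b)) \<longlonglongrightarrow> 0"
        using q1 q_nonneg by (auto intro!: tendsto_mult_left_zero LIMSEQ_realpow_zero)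
      moreover have "norm (g n y) \<le> q ^ n * (2 * b)" if "y \<in> K" for n y
        using that
      proof (induction n arbitrary: y)
        case (Suc n)
        have "norm (T' (f n) (g n) y) \<le> q * (q ^ n * (2 * b))"
          by (rule T'_on_K) (use Suc f_S0 f_S1 b_nonneg q_nonneg in auto)
        then show ?case by (simp add: g_Suc mult.assoc)
      qed (simp add: g_0 g0)
      ultimately have "(\<lambda>n. g n x) \<longlonglongrightarrow> 0"
        using x by (intro Lim_null_comparison[of "\<lambda>n. g n x" "\<lambda>n. q ^ n * (2 * b)"] always_eventually) auto
      moreover have "(\<lambda>n. g n x) \<longlonglongrightarrow> G x"
        using tendsto_uniform_limitI[OF lim] by simp
      ultimately show ?thesis using LIMSEQ_unique by blast
    qed
  qed
qed

end

section \<open>Gluing along similitudes\<close>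

text \<open>
  A similitude of a Euclidean space is \<open>\<phi> 0 + \<rho> Q\<close> with \<open>Q\<close> orthogonal, because an isometry that fixes the origin
  is linear.  Hence it is invertible, and the adjoint of the linear part of the inverse is \<open>Q / \<rho>\<close>.
\<close>

lemma similitude_pullback:
  fixes \<phi> :: "'a::euclidean_space \<Rightarrow> 'a"
  assumes \<phi>: "\<And>x y. dist (\<phi> x) (\<phi> y) = \<rho> * dist x y" and \<rho>: "0 < \<rho>"
  obtains \<psi> R where "\<And>x. \<psi> (\<phi> x) = x"
    "\<And>f g. has_C1_gradient f g \<Longrightarrow> has_C1_gradient (\<lambda>x. f (\<psi> x)) (\<lambda>x. R (g (\<psi> x)))"
    "\<And>v. norm (R v) = norm v / \<rho>" "\<And>v w. R (v - w) = R v - R w"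
proof -
  define Q where "Q x = (1 / \<rho>) *\<^sub>R (\<phi> x - \<phi> 0)" for x
  have "dist (Q x) (Q y) = dist x y" for x y
  proof -
    have "dist (Q x) (Q y) = norm ((1 / \<rho>) *\<^sub>R (\<phi> x - \<phi> y))"
      unfolding Q_def dist_norm scaleR_diff_right[symmetric] by simp
    also have "\<dots> = dist (\<phi> x) (\<phi> y) / \<rho>" using \<rho> by (simp add: dist_norm)
    finally show ?thesis using \<phi> \<rho> by simp
  qed
  then have Q: "orthogonal_transformation Q"
    by (simp add: orthogonal_transformation_isometry Q_def)
  then have lin: "linear Q" and inner_Q: "\<And>v w. Q v \<bullet> Q w = v \<bullet> w"
    by (simp_all add: orthogonal_transformation_def)
  have Q': "orthogonal_transformation (inv Q)"
    using Q by (rule orthogonal_transformation_inv)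
  have Q_inv: "Q (inv Q v) = v" for v
    using orthogonal_transformation_surj[OF Q] by (rule surj_f_inv_f)
  have inv_Q: "inv Q (Q v) = v" for v
    using orthogonal_transformation_inj[OF Q] by (rule inv_f_f)
  have blin: "bounded_linear (inv Q)"
    using Q' by (simp add: orthogonal_transformation_def linear_conv_bounded_linear)
  define \<psi> where "\<psi> y = inv Q ((1 / \<rho>) *\<^sub>R (y - \<phi> 0))" for y
  define R where "R v = (1 / \<rho>) *\<^sub>R Q v" for v
  have \<psi>_deriv: "(\<psi> has_derivative (\<lambda>h. inv Q ((1 / \<rho>) *\<^sub>R h))) (at x)" for x
    unfolding \<psi>_def[abs_def]
    by (rule bounded_linear.has_derivative[OF blin]) (auto intro!: derivative_eq_intros)
  have \<psi>_cont: "continuous_on UNIV \<psi>"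
    unfolding \<psi>_def[abs_def]
    by (intro bounded_linear.continuous_on[OF blin] continuous_intros)
  have R_cont: "continuous_on UNIV R"
    unfolding R_def[abs_def]
    using lin by (intro continuous_intros linear_continuous_on) (simp add: linear_conv_bounded_linear)
  show thesis
  proof
    show "\<psi> (\<phi> x) = x" for x
      unfolding \<psi>_def Q_def[symmetric] by (rule inv_Q)
    show "norm (R v) = norm v / \<rho>" for v
      using orthogonal_transformation_norm[OF Q] \<rho> by (simp add: R_def)
    show "R (v - w) = R v - R w" for v w
      by (simp add: R_def linear_diff[OF lin] scaleR_diff_right)
    fix f :: "'a \<Rightarrow> real" and g assume fg: "has_C1_gradient f g"
    have "GDERIV (\<lambda>x. f (\<psi> x)) x :> R (g (\<psi> x))" for x
    proof -
      have "((\<lambda>x. f (\<psi> x)) has_derivative (\<lambda>h. inv Q ((1 / \<rho>) *\<^sub>R h) \<bullet> g (\<psi> x))) (at x)"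
        using fg by (intro has_derivative_compose[OF \<psi>_deriv])
          (simp add: has_C1_gradient_def gderiv_def)
      moreover have "inv Q ((1 / \<rho>) *\<^sub>R h) \<bullet> g (\<psi> x) = h \<bullet> R (g (\<psi> x))" for h
        using inner_Q[of "inv Q ((1 / \<rho>) *\<^sub>R h)" "g (\<psi> x)"] by (simp add: Q_inv R_def)
      ultimately show ?thesis by (simp add: gderiv_def)
    qed
    moreover have "continuous_on UNIV (\<lambda>x. R (g (\<psi> x)))"
    proof -
      have "continuous_on UNIV g" using fg by (simp add: has_C1_gradient_def)
      then have "continuous_on UNIV (\<lambda>x. g (\<psi> x))"
        using continuous_on_compose2[OF _ \<psi>_cont] by blast
      then show ?thesis using continuous_on_compose2[OF R_cont] by blast
    qed
    ultimately show "has_C1_gradient (\<lambda>x. f (\<psi> x)) (\<lambda>x. R (g (\<psi> x)))"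
      by (simp add: has_C1_gradient_def)
  qed
qed

text \<open>
  The geometric form of the gluing.  \<open>Lo i\<close> and \<open>Hi i\<close> are the unions of the pieces before and after \<open>\<phi>\<^sub>i(K)\<close>, and
  \<open>M\<close> is the union of the inner pieces of \<open>K\<close>.  The step function for \<open>i\<close> separates the closed sets in the assumption
  on \<open>\<epsilon>\<close>, and the cutoff function is \<open>1\<close> on \<open>\<phi>\<^sub>i(M)\<close> and lives near that set.
\<close>

lemma exists_C1_self_similar_gluing:
  fixes K S0 S1 M :: "'a::euclidean_space set" and I :: "'i set"
    and \<phi> :: "'i \<Rightarrow> 'a \<Rightarrow> 'a" and \<rho> p \<epsilon> :: "'i \<Rightarrow> real" and Lo Hi :: "'i \<Rightarrow> 'a set"
  assumes I: "finite I" "I \<noteq> {}"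
    and p: "sum p I = 1" "\<And>i. i \<in> I \<Longrightarrow> 0 \<le> p i \<and> p i \<le> q * \<rho> i" and q: "q < 1"
    and \<rho>: "\<And>i. i \<in> I \<Longrightarrow> 0 < \<rho> i \<and> \<rho> i < 1"
    and \<phi>: "\<And>i x y. i \<in> I \<Longrightarrow> dist (\<phi> i x) (\<phi> i y) = \<rho> i * dist x y"
    and comp: "compact S0" "compact M" "compact S1"
      "\<And>i. i \<in> I \<Longrightarrow> compact (Lo i)" "\<And>i. i \<in> I \<Longrightarrow> compact (Hi i)"
    and K: "K = S0 \<union> M \<union> S1" and S0: "S0 \<noteq> {}"
    and cover: "\<And>i. i \<in> I \<Longrightarrow> K \<subseteq> Lo i \<union> \<phi> i ` K \<union> Hi i"
    and others: "\<And>i j. i \<in> I \<Longrightarrow> j \<in> I \<Longrightarrow> i \<noteq> j \<Longrightarrow> \<phi> j ` K \<subseteq> Lo i \<union> Hi i"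
    and ends: "\<And>i. i \<in> I \<Longrightarrow> S0 \<subseteq> Lo i \<and> S1 \<subseteq> Hi i"
    and mid: "\<And>i. i \<in> I \<Longrightarrow> \<phi> i ` M \<inter> (Lo i \<union> Hi i) = {}"
    and sides: "\<And>i. i \<in> I \<Longrightarrow>
      (\<epsilon> i = 1 \<and> (Lo i \<union> \<phi> i ` S0) \<inter> (Hi i \<union> \<phi> i ` S1) = {}) \<or>
      (\<epsilon> i = -1 \<and> (Lo i \<union> \<phi> i ` S1) \<inter> (Hi i \<union> \<phi> i ` S0) = {})"
  obtains F G where "has_C1_gradient F G" "\<And>x. x \<in> S0 \<Longrightarrow> F x = - 1" "\<And>x. x \<in> S1 \<Longrightarrow> F x = 1"
    "\<And>x. x \<in> K \<Longrightarrow> G x = 0"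
proof -
  have comp_image: "compact (\<phi> i ` S)" if "i \<in> I" "compact S" for i S
  proof (rule compact_continuous_image[OF _ that(2)])
    have "(\<rho> i)-lipschitz_on S (\<phi> i)"
      using \<rho>[OF that(1)] \<phi>[OF that(1)] by (intro lipschitz_onI) auto
    then show "continuous_on S (\<phi> i)" by (rule lipschitz_on_continuous_on)
  qed
  have "\<forall>i\<in>I. \<exists>\<psi> R. (\<forall>x. \<psi> (\<phi> i x) = x) \<and> (\<forall>f g. has_C1_gradient f g \<longrightarrow>
        has_C1_gradient (\<lambda>x. f (\<psi> x)) (\<lambda>x. R (g (\<psi> x)))) \<and>
      (\<forall>v. norm (R v) = norm v / \<rho> i) \<and> (\<forall>v w. R (v - w) = R v - R w)"
  proof
    fix i assume i: "i \<in> I"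
    show "\<exists>\<psi> R. (\<forall>x. \<psi> (\<phi> i x) = x) \<and> (\<forall>f g. has_C1_gradient f g \<longrightarrow>
        has_C1_gradient (\<lambda>x. f (\<psi> x)) (\<lambda>x. R (g (\<psi> x)))) \<and>
      (\<forall>v. norm (R v) = norm v / \<rho> i) \<and> (\<forall>v w. R (v - w) = R v - R w)"
      by (rule similitude_pullback[OF \<phi>[OF i]]) (use \<rho>[OF i] in auto)
  qed
  then obtain \<psi> R where \<psi>R: "\<forall>i\<in>I. (\<forall>x. \<psi> i (\<phi> i x) = x) \<and> (\<forall>f g. has_C1_gradient f g \<longrightarrow>
        has_C1_gradient (\<lambda>x. f (\<psi> i x)) (\<lambda>x. R i (g (\<psi> i x)))) \<and>
      (\<forall>v. norm (R i v) = norm v / \<rho> i) \<and> (\<forall>v w. R i (v - w) = R i v - R i w)"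
    by metis
  have "\<exists>\<delta>>0. \<forall>x\<in>\<phi> i ` M. \<forall>y\<in>Lo i \<union> Hi i. \<delta> \<le> dist x y" if i: "i \<in> I" for i
    using mid[OF i] comp(4,5)[OF i] comp_image[OF i comp(2)]
    by (intro separate_compact_closed closed_Un) (auto intro: compact_imp_closed)
  then obtain d where d: "\<And>i. i \<in> I \<Longrightarrow> d i > 0"
    "\<And>i x y. i \<in> I \<Longrightarrow> x \<in> \<phi> i ` M \<Longrightarrow> y \<in> Lo i \<union> Hi i \<Longrightarrow> d i \<le> dist x y"
    by metis
  \<comment> \<open>Halving the least distance makes the neighbourhoods of different \<open>\<phi>\<^sub>i(M)\<close> disjoint.\<close>
  define \<delta> where "\<delta> = Min (d ` I) / 2"
  have \<delta>: "\<delta> > 0" "\<And>i. i \<in> I \<Longrightarrow> 2 * \<delta> \<le> d i"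
    using I d(1) by (auto simp: \<delta>_def)
  define V where "V i = (\<Union>x\<in>\<phi> i ` M. ball x \<delta>)" for i
  have V_disj: "V i \<inter> V j = {}" if ij: "i \<in> I" "j \<in> I" "i \<noteq> j" for i j
  proof (rule ccontr)
    assume "V i \<inter> V j \<noteq> {}"
    then obtain z where "z \<in> V i" "z \<in> V j" by blast
    then obtain x y where xyz: "x \<in> \<phi> i ` M" "y \<in> \<phi> j ` M" "dist x z < \<delta>" "dist y z < \<delta>"
      unfolding V_def by (meson UN_E mem_ball)
    then have "y \<in> Lo i \<union> Hi i" using others[OF ij] K by blast
    then have "2 * \<delta> \<le> dist x y"
      using d(2)[OF ij(1) xyz(1)] \<delta>(2)[OF ij(1)] by (meson order_trans)
    then show False using xyz(3,4) dist_triangle2[of x y z] by simp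
  qed
  have V_sides: "x \<notin> V i" if i: "i \<in> I" and x: "x \<in> Lo i \<union> Hi i" for i x
  proof
    assume "x \<in> V i"
    then obtain y where "y \<in> \<phi> i ` M" "dist y x < \<delta>"
      unfolding V_def by (meson UN_E mem_ball)
    then show False using d(2)[OF i _ x, of y] \<delta>(1) \<delta>(2)[OF i] by linarith
  qed
  have "\<forall>i\<in>I. \<exists>k k'. has_C1_gradient k k' \<and> (\<forall>x. 0 \<le> k x \<and> k x \<le> 1)
      \<and> (\<forall>x\<in>\<phi> i ` M. k x = 1 \<and> k' x = 0) \<and> (\<forall>x\<in>- V i. k x = 0 \<and> k' x = 0)
      \<and> bounded (range k')"
  proof
    fix i assume i: "i \<in> I"
    have "closed (- V i)" by (auto simp: V_def)
    moreover have "\<phi> i ` M \<inter> - V i = {}" using \<delta>(1) by (force simp: V_def)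
    ultimately show "\<exists>k k'. has_C1_gradient k k' \<and> (\<forall>x. 0 \<le> k x \<and> k x \<le> 1)
      \<and> (\<forall>x\<in>\<phi> i ` M. k x = 1 \<and> k' x = 0) \<and> (\<forall>x\<in>- V i. k x = 0 \<and> k' x = 0)
      \<and> bounded (range k')"
      by (rule C1_Urysohn[OF comp_image[OF i comp(2)]]) blast
  qed
  then obtain \<kappa> \<kappa>' where \<kappa>: "\<forall>i\<in>I. has_C1_gradient (\<kappa> i) (\<kappa>' i) \<and> (\<forall>x. 0 \<le> \<kappa> i x \<and> \<kappa> i x \<le> 1)
      \<and> (\<forall>x\<in>\<phi> i ` M. \<kappa> i x = 1 \<and> \<kappa>' i x = 0) \<and> (\<forall>x\<in>- V i. \<kappa> i x = 0 \<and> \<kappa>' i x = 0)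
      \<and> bounded (range (\<kappa>' i))"
    by metis
  \<comment> \<open>The ends at which the zipper enters and leaves \<open>\<phi>\<^sub>i(K)\<close>.\<close>
  define In where "In i = (if \<epsilon> i = 1 then S0 else S1)" for i
  define Out where "Out i = (if \<epsilon> i = 1 then S1 else S0)" for i
  have \<epsilon>: "\<epsilon> i = 1 \<or> \<epsilon> i = - 1" if "i \<in> I" for i using sides[OF that] by blast
  have "\<forall>i\<in>I. \<exists>u u'. has_C1_gradient u u' \<and> (\<forall>x. \<bar>u x\<bar> \<le> 1)
      \<and> (\<forall>x\<in>Lo i \<union> \<phi> i ` In i. u x = - 1 \<and> u' x = 0) \<and> (\<forall>x\<in>Hi i \<union> \<phi> i ` Out i. u x = 1 \<and> u' x = 0)
      \<and> bounded (range u')"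
  proof
    fix i assume i: "i \<in> I"
    have "compact (Hi i \<union> \<phi> i ` Out i)" "closed (Lo i \<union> \<phi> i ` In i)"
      using comp i comp_image by (auto simp: In_def Out_def intro!: compact_Un compact_imp_closed)
    moreover have "(Hi i \<union> \<phi> i ` Out i) \<inter> (Lo i \<union> \<phi> i ` In i) = {}"
      using sides[OF i] by (auto simp: In_def Out_def)
    ultimately obtain k k' where k: "has_C1_gradient k k'" "\<And>x. 0 \<le> k x \<and> k x \<le> 1"
      "\<And>x. x \<in> Hi i \<union> \<phi> i ` Out i \<Longrightarrow> k x = 1 \<and> k' x = 0"
      "\<And>x. x \<in> Lo i \<union> \<phi> i ` In i \<Longrightarrow> k x = 0 \<and> k' x = 0" "bounded (range k')"
      by (rule C1_Urysohn) blast
    have "has_C1_gradient (\<lambda>x. - 1 + 2 * k x) (\<lambda>x. 0 + 2 *\<^sub>R k' x)"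
      by (intro has_C1_gradient_add has_C1_gradient_const has_C1_gradient_cmult k)
    moreover have "\<bar>- 1 + 2 * k x\<bar> \<le> 1" for x using k(2)[of x] by (simp add: abs_le_iff)
    moreover have "bounded (range (\<lambda>x. 0 + 2 *\<^sub>R k' x))"
      using bounded_scaling[OF k(5), of 2] by (simp add: image_image)
    ultimately show "\<exists>u u'. has_C1_gradient u u' \<and> (\<forall>x. \<bar>u x\<bar> \<le> 1)
      \<and> (\<forall>x\<in>Lo i \<union> \<phi> i ` In i. u x = - 1 \<and> u' x = 0) \<and> (\<forall>x\<in>Hi i \<union> \<phi> i ` Out i. u x = 1 \<and> u' x = 0)
      \<and> bounded (range u')"
      using k(3,4)
      by (intro exI[of _ "\<lambda>x. - 1 + 2 * k x"] exI[of _ "\<lambda>x. 0 + 2 *\<^sub>R k' x"] conjI) auto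
  qed
  then obtain u u' where u: "\<forall>i\<in>I. has_C1_gradient (u i) (u' i) \<and> (\<forall>x. \<bar>u i x\<bar> \<le> 1)
      \<and> (\<forall>x\<in>Lo i \<union> \<phi> i ` In i. u i x = - 1 \<and> u' i x = 0) \<and> (\<forall>x\<in>Hi i \<union> \<phi> i ` Out i. u i x = 1 \<and> u' i x = 0)
      \<and> bounded (range (u' i))"
    by metis
  have "\<forall>i\<in>I. \<exists>b. \<forall>x. norm (\<kappa>' i x) \<le> b \<and> norm (u' i x) \<le> b"
  proof
    fix i assume "i \<in> I"
    then have "bounded (range (\<kappa>' i))" "bounded (range (u' i))" using \<kappa> u by auto
    then obtain b1 b2 where "\<forall>x. norm (\<kappa>' i x) \<le> b1" "\<forall>x. norm (u' i x) \<le> b2"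
      unfolding bounded_iff by blast
    then show "\<exists>b. \<forall>x. norm (\<kappa>' i x) \<le> b \<and> norm (u' i x) \<le> b"
      by (intro exI[of _ "max b1 b2"]) (auto simp: le_max_iff_disj)
  qed
  then obtain b where b: "\<And>i x. i \<in> I \<Longrightarrow> norm (\<kappa>' i x) \<le> b i \<and> norm (u' i x) \<le> b i" by metis
  define C where "C = Max (b ` I)"
  have C: "norm (\<kappa>' i x) \<le> C \<and> norm (u' i x) \<le> C" if "i \<in> I" for i x
  proof -
    have "b i \<le> C" unfolding C_def using I that by (intro Max_ge) auto
    then show ?thesis using b[OF that, of x] by linarith
  qed
  have \<psi>: "\<psi> i (\<phi> i x) = x" if "i \<in> I" for i x using \<psi>R that by blast
  have \<kappa>_C1: "has_C1_gradient (\<kappa> i) (\<kappa>' i)" "0 \<le> \<kappa> i x \<and> \<kappa> i x \<le> 1" if "i \<in> I" for i x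
    using \<kappa> that by blast+
  have \<kappa>_V: "\<kappa> i x = 0 \<and> \<kappa>' i x = 0" if "i \<in> I" "x \<notin> V i" for i x
    using \<kappa> that by blast
  have \<kappa>_M: "\<kappa> i (\<phi> i y) = 1 \<and> \<kappa>' i (\<phi> i y) = 0" if "i \<in> I" "y \<in> M" for i y
    using \<kappa> that by blast
  have u_C1: "has_C1_gradient (u i) (u' i)" "\<bar>u i x\<bar> \<le> 1" if "i \<in> I" for i x
    using u that by blast+
  have u_Lo: "u i x = - 1 \<and> u' i x = 0" if "i \<in> I" "x \<in> Lo i \<or> x \<in> \<phi> i ` In i" for i x
    using u that by blast
  have u_Hi: "u i x = 1 \<and> u' i x = 0" if "i \<in> I" "x \<in> Hi i \<or> x \<in> \<phi> i ` Out i" for i x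
    using u that by blast
  interpret gluing_operator K S0 S1 I p \<epsilon> \<rho> q C \<psi> R \<kappa> u \<kappa>' u'
  proof
    show "(\<kappa> i x = 0 \<and> \<kappa>' i x = 0) \<or> (\<kappa> j x = 0 \<and> \<kappa>' j x = 0)" if "i \<in> I" "j \<in> I" "i \<noteq> j" for i j x
      using V_disj[OF that] \<kappa>_V that by blast
    show "\<kappa> i x = 0 \<and> u i x = -1" if "i \<in> I" "x \<in> S0" for i x
      using ends[OF that(1)] that V_sides \<kappa>_V u_Lo by blast
    show "\<kappa> i x = 0 \<and> u i x = 1" if "i \<in> I" "x \<in> S1" for i x
      using ends[OF that(1)] that V_sides \<kappa>_V u_Hi by blast
    show "S0 \<inter> S1 = {}" using ends sides I(2) by blast
    show "(\<kappa> i x = 0 \<and> \<kappa>' i x = 0 \<and> u' i x = 0) \<or>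
        (\<psi> i x \<in> K \<and>
          (\<kappa> i x = 1 \<and> \<kappa>' i x = 0 \<or>
           u' i x = 0 \<and> (\<psi> i x \<in> S0 \<and> u i x = - \<epsilon> i \<or> \<psi> i x \<in> S1 \<and> u i x = \<epsilon> i)))"
      if i: "i \<in> I" and x: "x \<in> K" for i x
    proof (cases "x \<in> Lo i \<union> Hi i")
      case True
      then show ?thesis using V_sides[OF i True] \<kappa>_V[OF i] u_Lo[OF i] u_Hi[OF i] by blast
    next
      case False
      then obtain y where y: "y \<in> K" "x = \<phi> i y" using cover[OF i] x by blast
      have \<psi>x: "\<psi> i x = y" using \<psi>[OF i] y(2) by simp
      consider "y \<in> M" | "y \<in> S0" | "y \<in> S1" using y(1) K by blast
      then show ?thesis
      proof cases
        case 1
        then show ?thesis using \<kappa>_M[OF i 1] y \<psi>x by simp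
      next
        case 2
        then have "u' i x = 0 \<and> u i x = - \<epsilon> i"
          using u_Lo[OF i, of x] u_Hi[OF i, of x] y(2) \<epsilon>[OF i]
          by (cases "\<epsilon> i = 1") (auto simp: In_def Out_def)
        then show ?thesis using 2 y(1) \<psi>x by simp
      next
        case 3
        then have "u' i x = 0 \<and> u i x = \<epsilon> i"
          using u_Lo[OF i, of x] u_Hi[OF i, of x] y(2) \<epsilon>[OF i]
          by (cases "\<epsilon> i = 1") (auto simp: In_def Out_def)
        then show ?thesis using 3 y(1) \<psi>x by simp
      qed
    qed
    show "\<bar>\<epsilon> i\<bar> = 1" if "i \<in> I" for i using \<epsilon>[OF that] by auto
  qed (use I p q \<rho> comp S0 \<psi>R \<kappa>_C1 u_C1 C in \<open>simp_all add: less_imp_le\<close>)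
  show thesis by (rule exists_glued_limit[OF that])
qed


section \<open>Connectedness of iterated chains\<close>

text \<open>
  Suppose that a two-valued function on \<open>K\<close> takes equal values at points of distance less than \<open>\<eta>\<close>.  Composed with
  one of the contractions, it does so for distances less than \<open>\<eta> / r\<close>.  After finitely many steps the scale exceeds
  the diameter of \<open>K\<close>, where the function must be constant; going back, it is constant on every piece, and since
  consecutive pieces meet, on \<open>K\<close>.
\<close>

lemma connected_iterated_chain:
  fixes K :: "'a::heine_borel set"
  assumes K: "compact K" "K = (\<Union>l<n. A l)" and r: "0 < r" "r < 1"
    and meet: "\<And>l. Suc l < n \<Longrightarrow> A l \<inter> A (Suc l) \<noteq> {}"
    and pieces: "\<And>l. l < n \<Longrightarrow> connected (A l) \<or>
      (\<exists>\<phi>. A l = \<phi> ` K \<and> (\<forall>x y. dist (\<phi> x) (\<phi> y) \<le> r * dist x y))"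
  shows "connected K"
proof -
  obtain D where D: "\<And>x y. x \<in> K \<Longrightarrow> y \<in> K \<Longrightarrow> dist x y \<le> D"
    using diameter_bounded_bound[OF compact_imp_bounded[OF K(1)]] by blast
  have const: "h x = h y"
    if "r ^ k * D < \<eta>" "0 < \<eta>" "\<And>x y. x \<in> K \<Longrightarrow> y \<in> K \<Longrightarrow> dist x y < \<eta> \<Longrightarrow> h x = h y" "x \<in> K" "y \<in> K"
    for k \<eta> x y and h :: "'a \<Rightarrow> bool"
    using that
  proof (induction k arbitrary: h \<eta> x y)
    case 0
    then show ?case using D[OF 0(4,5)] by (intro 0(3)) auto
  next
    case (Suc k)
    have piece: "h x = h y" if l: "l < n" and xy: "x \<in> A l" "y \<in> A l" for l x y
      using pieces[OF l]
    proof
      assume "connected (A l)"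
      then show ?thesis using xy
      proof (rule connected_local_const)
        show "\<forall>a\<in>A l. \<forall>\<^sub>F b in at a within A l. h a = h b"
          unfolding eventually_at
        proof (intro ballI exI[of _ \<eta>] conjI impI)
          fix a b assume "a \<in> A l" "b \<in> A l" "b \<noteq> a \<and> dist b a < \<eta>"
          then show "h a = h b" using Suc.prems(3)[of a b] l K(2) by (auto simp: dist_commute)
        qed (rule Suc.prems(2))
      qed
    next
      assume "\<exists>\<phi>. A l = \<phi> ` K \<and> (\<forall>x y. dist (\<phi> x) (\<phi> y) \<le> r * dist x y)"
      then obtain \<phi> where \<phi>: "A l = \<phi> ` K" "\<And>x y. dist (\<phi> x) (\<phi> y) \<le> r * dist x y" by blast
      obtain x' y' where x'y': "x' \<in> K" "y' \<in> K" "x = \<phi> x'" "y = \<phi> y'" using xy \<phi>(1) by blast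
      have "(h \<circ> \<phi>) x' = (h \<circ> \<phi>) y'"
      proof (rule Suc.IH)
        show "r ^ k * D < \<eta> / r" using Suc.prems(1) r(1) by (simp add: field_simps)
        show "0 < \<eta> / r" using Suc.prems(2) r(1) by simp
        fix v w assume vw: "v \<in> K" "w \<in> K" "dist v w < \<eta> / r"
        then have "dist (\<phi> v) (\<phi> w) < \<eta>"
          using \<phi>(2)[of v w] r(1) by (simp add: field_simps)
        moreover have "\<phi> v \<in> K" "\<phi> w \<in> K" using vw \<phi>(1) K(2) l by blast+
        ultimately show "(h \<circ> \<phi>) v = (h \<circ> \<phi>) w" using Suc.prems(3) by simp
      qed (rule x'y')+
      then show ?thesis using x'y' by simp
    qed
    have chain: "h x = h y" if "l < n" "x \<in> A 0" "y \<in> A l" for l x y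
      using that
    proof (induction l arbitrary: y)
      case 0
      then show ?case using piece by blast
    next
      case (Suc l)
      then obtain z where "z \<in> A l" "z \<in> A (Suc l)" using meet by blast
      then show ?case using Suc piece[of "Suc l" z y] by auto
    qed
    obtain i j where ij: "i < n" "j < n" "x \<in> A i" "y \<in> A j" using Suc.prems(4,5) K(2) by blast
    have "A 0 \<noteq> {}"
    proof (cases "n = 1")
      case False
      then show ?thesis using meet[of 0] ij(1) by auto
    qed (use ij in auto)
    then show ?case using chain ij by blast
  qed
  show ?thesis
  proof (rule ccontr)
    assume "\<not> connected K"
    then obtain U V where UV: "closed U" "closed V" "K \<subseteq> U \<union> V" "U \<inter> V \<inter> K = {}"
      "U \<inter> K \<noteq> {}" "V \<inter> K \<noteq> {}" unfolding connected_closed by blast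
    obtain \<eta> where \<eta>: "\<eta> > 0" "\<And>x y. x \<in> U \<inter> K \<Longrightarrow> y \<in> V \<inter> K \<Longrightarrow> \<eta> \<le> dist x y"
      using separate_compact_closed[of "U \<inter> K" "V \<inter> K"] UV K(1)
      by (metis closed_Int_compact compact_imp_closed inf_assoc inf_left_commute inf.idem)
    have "(\<lambda>k. r ^ k * D) \<longlonglongrightarrow> 0"
      using r by (intro tendsto_mult_left_zero LIMSEQ_realpow_zero) auto
    then have "\<forall>\<^sub>F k in sequentially. r ^ k * D < \<eta>" using \<eta>(1) by (rule order_tendstoD)
    then obtain k where k: "r ^ k * D < \<eta>" by (auto simp: eventually_sequentially)
    obtain x y where xy: "x \<in> U \<inter> K" "y \<in> V \<inter> K" using UV(5,6) by blast
    have "(x \<in> U) = (y \<in> U)"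
    proof (rule const[OF k \<eta>(1)])
      fix v w assume "v \<in> K" "w \<in> K" "dist v w < \<eta>"
      then show "(v \<in> U) = (w \<in> U)"
        using \<eta>(2)[of v w] \<eta>(2)[of w v] UV(3) by (auto simp: dist_commute)
    qed (use xy in auto)
    then show False using xy UV(4) by blast
  qed
qed

section \<open>Hausdorff dimension and contraction ratios\<close>

lemma diameter_similitude_image_le:
  assumes "bounded U" and \<phi>: "\<And>x y. dist (\<phi> x) (\<phi> y) = \<rho> * dist x y" and "0 \<le> \<rho>"
  shows "diameter (\<phi> ` U) \<le> \<rho> * diameter U"
proof (cases "U = {}")
  case False
  have "(SUP (x, y)\<in>\<phi> ` U \<times> \<phi> ` U. dist x y) \<le> \<rho> * diameter U"
  proof (rule cSUP_least)
    fix z assume "z \<in> \<phi> ` U \<times> \<phi> ` U"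
    then obtain x y where "x \<in> U" "y \<in> U" "z = (\<phi> x, \<phi> y)" by blast
    then show "(case z of (x, y) \<Rightarrow> dist x y) \<le> \<rho> * diameter U"
      using diameter_bounded_bound[OF assms(1)] \<phi> \<open>0 \<le> \<rho>\<close> by (simp add: mult_left_mono)
  qed (use False in simp)
  with False show ?thesis by (simp add: diameter_def)
qed (simp add: diameter_def)

lemma bounded_similitude_image:
  fixes \<phi> :: "'a::metric_space \<Rightarrow> 'b::metric_space"
  assumes "bounded U" and \<phi>: "\<And>x y. dist (\<phi> x) (\<phi> y) = \<rho> * dist x y" and "0 \<le> \<rho>"
  shows "bounded (\<phi> ` U)"
proof -
  obtain x r where r: "\<And>y. y \<in> U \<Longrightarrow> dist x y \<le> r" using assms(1) unfolding bounded_def by blast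
  then have "dist (\<phi> x) (\<phi> y) \<le> \<rho> * r" if "y \<in> U" for y
    using that assms by (simp add: mult_left_mono)
  then show ?thesis unfolding bounded_def by blast
qed

text \<open>
  Finite covers are padded with empty sets, which contribute nothing to the premeasure.
\<close>

lemma hausdorff_premeasure_le_list_cover:
  assumes "s > 0" and E: "E \<subseteq> \<Union>(set Us)"
    and Us: "\<And>U. U \<in> set Us \<Longrightarrow> bounded U \<and> U \<noteq> {} \<and> diameter U \<le> \<delta>" and "0 \<le> \<delta>"
  shows "hausdorff_premeasure s \<delta> E \<le> ennreal (\<Sum>U\<leftarrow>Us. diameter U powr s)"
proof -
  define V where "V i = (if i < length Us then Us ! i else {})" for i
  have "E \<subseteq> (\<Union>i. V i)"
    using E by (force simp: V_def in_set_conv_nth)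
  moreover have "bounded (V i) \<and> diameter (V i) \<le> \<delta>" for i
    using Us \<open>0 \<le> \<delta>\<close> by (auto simp: V_def)
  ultimately have "hausdorff_premeasure s \<delta> E
      \<le> (\<Sum>i. if V i = {} then 0 else if s = 0 then 1 else ennreal (diameter (V i) powr s))"
    unfolding hausdorff_premeasure_def by (intro INF_lower) blast
  also have "\<dots> = (\<Sum>i<length Us. ennreal (diameter (Us ! i) powr s))"
    using \<open>s > 0\<close> Us
    by (subst suminf_finite[of "{..<length Us}"]) (auto simp: V_def intro!: sum.cong)
  also have "\<dots> = ennreal (\<Sum>U\<leftarrow>Us. diameter U powr s)"
    by (simp add: sum_ennreal sum_list_sum_nth atLeast0LessThan)
  finally show ?thesis .
qed

text \<open>
  The images of \<open>E\<close> under words of length \<open>k\<close> cover \<open>E\<close>, their diameters are at most \<open>r ^ k\<close> times that of \<open>E\<close>, where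
  \<open>r < 1\<close> is the largest ratio, and the sum of the \<open>s\<close>-th powers of the diameters gains the factor \<open>\<Sum> \<rho>\<^sub>i\<^sup>s < 1\<close> at each step.
\<close>

lemma hausdorff_measure_self_similar_eq_0:
  fixes \<phi>s :: "('a::metric_space \<Rightarrow> 'a) list" and \<rho> :: "('a \<Rightarrow> 'a) \<Rightarrow> real"
  assumes \<rho>: "\<And>\<phi>. \<phi> \<in> set \<phi>s \<Longrightarrow> 0 < \<rho> \<phi> \<and> \<rho> \<phi> < 1"
    and \<phi>: "\<And>\<phi> x y. \<phi> \<in> set \<phi>s \<Longrightarrow> dist (\<phi> x) (\<phi> y) = \<rho> \<phi> * dist x y"
    and E: "bounded E" "E \<noteq> {}" "E \<subseteq> (\<Union>\<phi>\<in>set \<phi>s. \<phi> ` E)"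
    and s: "s > 0" and sum: "(\<Sum>\<phi>\<leftarrow>\<phi>s. \<rho> \<phi> powr s) < 1"
  shows "hausdorff_measure s E = 0"
proof -
  let ?D = "diameter E" and ?\<sigma> = "\<Sum>\<phi>\<leftarrow>\<phi>s. \<rho> \<phi> powr s"
  have \<sigma>: "0 \<le> ?\<sigma>" by (intro sum_list_nonneg) auto
  define r where "r = Max (insert 0 (\<rho> ` set \<phi>s))"
  have r: "0 \<le> r" "r < 1" "\<And>\<phi>. \<phi> \<in> set \<phi>s \<Longrightarrow> \<rho> \<phi> \<le> r"
    using \<rho> by (auto simp: r_def)
  have covers: "\<exists>Us. E \<subseteq> \<Union>(set Us) \<and> (\<forall>U\<in>set Us. bounded U \<and> U \<noteq> {} \<and> diameter U \<le> r ^ k * ?D)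
      \<and> (\<Sum>U\<leftarrow>Us. diameter U powr s) \<le> ?\<sigma> ^ k * ?D powr s" for k
  proof (induction k)
    case 0
    show ?case using E by (intro exI[of _ "[E]"]) simp
  next
    case (Suc k)
    then obtain Us where Us: "E \<subseteq> \<Union>(set Us)"
      "\<And>U. U \<in> set Us \<Longrightarrow> bounded U \<and> U \<noteq> {} \<and> diameter U \<le> r ^ k * ?D"
      "(\<Sum>U\<leftarrow>Us. diameter U powr s) \<le> ?\<sigma> ^ k * ?D powr s" by blast
    define Ws where "Ws = concat (map (\<lambda>\<phi>. map ((`) \<phi>) Us) \<phi>s)"
    have diam: "diameter (\<phi> ` U) \<le> \<rho> \<phi> * diameter U" if "\<phi> \<in> set \<phi>s" "U \<in> set Us" for \<phi> U
      using that \<rho> \<phi> Us(2) by (intro diameter_similitude_image_le) (auto simp: less_imp_le)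
    have "E \<subseteq> \<Union>(set Ws)"
    proof
      fix x assume "x \<in> E"
      then obtain \<phi> y where "\<phi> \<in> set \<phi>s" "y \<in> E" "x = \<phi> y" using E(3) by blast
      moreover from this obtain U where "U \<in> set Us" "y \<in> U" using Us(1) by blast
      ultimately show "x \<in> \<Union>(set Ws)" by (auto simp: Ws_def)
    qed
    moreover have "bounded W \<and> W \<noteq> {} \<and> diameter W \<le> r ^ Suc k * ?D" if in_Ws: "W \<in> set Ws" for W
    proof -
      obtain \<phi> U where W: "\<phi> \<in> set \<phi>s" "U \<in> set Us" "W = \<phi> ` U" using in_Ws by (auto simp: Ws_def)
      have "\<rho> \<phi> * diameter U \<le> r * (r ^ k * ?D)"
        using Us(2)[OF W(2)] r \<rho>[OF W(1)] W(1) by (intro mult_mono diameter_ge_0) auto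
      moreover have "bounded W"
        unfolding W(3) using W(1,2) Us(2) \<phi> \<rho>
        by (intro bounded_similitude_image[where \<rho>="\<rho> \<phi>"]) (auto simp: less_imp_le)
      ultimately show ?thesis using diam[OF W(1,2)] Us(2)[OF W(2)] W(3) by (simp add: mult.assoc)
    qed
    moreover have "(\<Sum>W\<leftarrow>Ws. diameter W powr s) \<le> ?\<sigma> ^ Suc k * ?D powr s"
    proof -
      have concat: "(\<Sum>W\<leftarrow>concat (map F fs). d W) = (\<Sum>f\<leftarrow>fs. \<Sum>W\<leftarrow>F f. d W)"
        for F :: "('a \<Rightarrow> 'a) \<Rightarrow> 'a set list" and fs and d :: "'a set \<Rightarrow> real"
        by (induction fs) simp_all
      have "(\<Sum>W\<leftarrow>Ws. diameter W powr s) = (\<Sum>\<phi>\<leftarrow>\<phi>s. \<Sum>U\<leftarrow>Us. diameter (\<phi> ` U) powr s)"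
        unfolding Ws_def by (simp add: concat o_def)
      also have "\<dots> \<le> (\<Sum>\<phi>\<leftarrow>\<phi>s. \<Sum>U\<leftarrow>Us. \<rho> \<phi> powr s * diameter U powr s)"
      proof (intro sum_list_mono)
        fix \<phi> U assume *: "\<phi> \<in> set \<phi>s" "U \<in> set Us"
        have "bounded (\<phi> ` U)"
          using * Us(2) \<phi> \<rho> by (intro bounded_similitude_image[where \<rho>="\<rho> \<phi>"]) (auto simp: less_imp_le)
        then have "diameter (\<phi> ` U) powr s \<le> (\<rho> \<phi> * diameter U) powr s"
          using s by (intro powr_mono2 diam[OF *] diameter_ge_0) auto
        then show "diameter (\<phi> ` U) powr s \<le> \<rho> \<phi> powr s * diameter U powr s"
          using * \<rho> Us(2) by (simp add: powr_mult less_imp_le diameter_ge_0)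
      qed
      also have "\<dots> = ?\<sigma> * (\<Sum>U\<leftarrow>Us. diameter U powr s)"
        by (simp add: sum_list_const_mult sum_list_mult_const)
      also have "\<dots> \<le> ?\<sigma> * (?\<sigma> ^ k * ?D powr s)"
        using Us(3) \<sigma> by (intro mult_left_mono)
      finally show ?thesis by (simp add: mult.assoc)
    qed
    ultimately show ?case by (intro exI[of _ Ws] conjI ballI) auto
  qed
  have "hausdorff_premeasure s \<delta> E \<le> 0" if \<delta>: "\<delta> > 0" for \<delta>
  proof (rule tendsto_lowerbound)
    have "(\<lambda>k. ?\<sigma> ^ k * ?D powr s) \<longlonglongrightarrow> 0"
      using \<sigma> sum by (intro tendsto_mult_left_zero LIMSEQ_realpow_zero)
    then show "((\<lambda>k. ennreal (?\<sigma> ^ k * ?D powr s)) \<longlongrightarrow> 0) sequentially"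
      using tendsto_ennrealI by fastforce
    have "(\<lambda>k. r ^ k * ?D) \<longlonglongrightarrow> 0"
      using r by (auto intro!: tendsto_mult_left_zero LIMSEQ_realpow_zero)
    then have "\<forall>\<^sub>F k in sequentially. r ^ k * ?D < \<delta>" using \<delta> by (rule order_tendstoD)
    then show "\<forall>\<^sub>F k in sequentially. hausdorff_premeasure s \<delta> E \<le> ennreal (?\<sigma> ^ k * ?D powr s)"
    proof eventually_elim
      case (elim k)
      obtain Us where Us: "E \<subseteq> \<Union>(set Us)"
        "\<forall>U\<in>set Us. bounded U \<and> U \<noteq> {} \<and> diameter U \<le> r ^ k * ?D"
        "(\<Sum>U\<leftarrow>Us. diameter U powr s) \<le> ?\<sigma> ^ k * ?D powr s" using covers[of k] by blast
      have "hausdorff_premeasure s \<delta> E \<le> ennreal (\<Sum>U\<leftarrow>Us. diameter U powr s)"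
        using Us(2) elim \<delta> by (intro hausdorff_premeasure_le_list_cover[OF s Us(1)]) force+
      also have "\<dots> \<le> ennreal (?\<sigma> ^ k * ?D powr s)" by (intro ennreal_leI Us)
      finally show ?case .
    qed
  qed simp
  then have "hausdorff_measure s E \<le> 0"
    unfolding hausdorff_measure_def by (intro SUP_least) auto
  then show ?thesis by simp
qed

lemma hausdorff_dim_gt_1_imp_sum_powr_ge_1:
  fixes \<phi>s :: "('a::metric_space \<Rightarrow> 'a) list" and \<rho> :: "('a \<Rightarrow> 'a) \<Rightarrow> real"
  assumes \<rho>: "\<And>\<phi>. \<phi> \<in> set \<phi>s \<Longrightarrow> 0 < \<rho> \<phi> \<and> \<rho> \<phi> < 1"
    and \<phi>: "\<And>\<phi> x y. \<phi> \<in> set \<phi>s \<Longrightarrow> dist (\<phi> x) (\<phi> y) = \<rho> \<phi> * dist x y"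
    and E: "ifs_attractor \<phi>s E" and dim: "hausdorff_dim E > 1"
  obtains t where "t > 1" "(\<Sum>\<phi>\<leftarrow>\<phi>s. \<rho> \<phi> powr t) \<ge> 1"
proof -
  obtain c where c: "1 < c" "c < hausdorff_dim E" using dim dense by blast
  then have "c < top" by (metis order.strict_trans2 top_greatest)
  then obtain t where t: "c = ennreal t" "0 \<le> t" by (metis ennreal_cases less_irrefl)
  have "t > 1" using c(1) t ennreal_less_iff[of 1 t] by simp
  have "hausdorff_measure t E \<noteq> 0"
  proof
    assume "hausdorff_measure t E = 0"
    then have "hausdorff_dim E \<le> ennreal t"
      unfolding hausdorff_dim_def using t(2) by (intro INF_lower) auto
    then show False using c(2) t(1) by simp
  qed
  moreover have "bounded E" "E \<noteq> {}" "E \<subseteq> (\<Union>\<phi>\<in>set \<phi>s. \<phi> ` E)"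
    using E compact_imp_bounded by (auto simp: ifs_attractor_def)
  ultimately have "\<not> (\<Sum>\<phi>\<leftarrow>\<phi>s. \<rho> \<phi> powr t) < 1"
    using hausdorff_measure_self_similar_eq_0[of \<phi>s \<rho> E t] \<rho> \<phi> \<open>t > 1\<close> by force
  then show thesis using that[OF \<open>t > 1\<close>] by simp
qed

text \<open>
  The weights are proportional to \<open>\<rho>\<^sub>i\<^sup>t\<close>.  Normalisation does not increase them because the sum is at least \<open>1\<close>, and
  \<open>\<rho>\<^sub>i\<^sup>t\<close> is smaller than \<open>\<rho>\<^sub>i\<close> by the factor \<open>\<rho>\<^sub>i\<^sup>t\<^sup>-\<^sup>1\<close>, which is less than \<open>1\<close> because \<open>t > 1\<close>.
\<close>

lemma similitude_weights:
  fixes \<rho> :: "nat \<Rightarrow> real"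
  assumes \<rho>: "\<And>i. i < N \<Longrightarrow> 0 < \<rho> i \<and> \<rho> i < 1" and t: "t > 1" and sum: "1 \<le> (\<Sum>i<N. \<rho> i powr t)"
  obtains w q where "(\<Sum>i<N. w i) = 1" "\<And>i. i < N \<Longrightarrow> 0 \<le> w i \<and> w i \<le> q * \<rho> i" "q < (1::real)"
proof
  let ?\<sigma> = "\<Sum>i<N. \<rho> i powr t" and ?q = "Max (insert 0 ((\<lambda>i. \<rho> i powr (t - 1)) ` {..<N}))"
  show "(\<Sum>i<N. \<rho> i powr t / ?\<sigma>) = 1"
    using sum by (simp flip: sum_divide_distrib)
  show "0 \<le> \<rho> i powr t / ?\<sigma> \<and> \<rho> i powr t / ?\<sigma> \<le> ?q * \<rho> i" if "i < N" for i
  proof -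
    have "\<rho> i powr t / ?\<sigma> \<le> \<rho> i powr t / 1"
      using sum by (intro divide_left_mono) auto
    also have "\<dots> = \<rho> i powr (t - 1) * \<rho> i"
      using \<rho>[OF that] by (simp add: powr_diff)
    also have "\<dots> \<le> ?q * \<rho> i"
      using \<rho>[OF that] that by (intro mult_right_mono Max_ge) auto
    finally show ?thesis using sum by simp
  qed
  have "\<rho> i powr (t - 1) < 1" if "i < N" for i
    using \<rho>[OF that] t powr_less_mono2[of "t - 1" "\<rho> i" 1] by simp
  then show "?q < 1" by auto
qed

section \<open>Zippers\<close>

text \<open>
  The combinatorics of a zipper decomposition whose \<open>l\<close>-th piece is \<open>A l\<close> with endpoints \<open>p l\<close> and \<open>q l\<close>.  Together,
  \<open>link\<close> and \<open>near\<close> say that two consecutive pieces meet in their common endpoint only.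
\<close>

locale zipper_chain =
  fixes n :: nat and A :: "nat \<Rightarrow> 'a set" and p q :: "nat \<Rightarrow> 'a"
  assumes ends_ne: "\<And>l. l < n \<Longrightarrow> p l \<noteq> q l"
    and ends_in: "\<And>l. l < n \<Longrightarrow> p l \<in> A l" "\<And>l. l < n \<Longrightarrow> q l \<in> A l"
    and link: "\<And>l. Suc l < n \<Longrightarrow> q l = p (Suc l)"
    and far: "\<And>l l'. Suc l < l' \<Longrightarrow> l' < n \<Longrightarrow> A l \<inter> A l' = {}"
    and near: "\<And>l. Suc l < n \<Longrightarrow> \<exists>x. A l \<inter> A (Suc l) = {x}"
begin

lemma meet:
  assumes "l < l'" "l' < n" "x \<in> A l" "x \<in> A l'"
  shows "l' = Suc l" "x = q l" "x = p l'"
proof -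
  show l': "l' = Suc l" using far[of l l'] assms by force
  obtain z where z: "A l \<inter> A (Suc l) = {z}" using near assms l' by blast
  have "q l \<in> A l \<inter> A (Suc l)" using link[of l] ends_in(1)[of "Suc l"] ends_in(2)[of l] assms l' by auto
  then show "x = q l" using z assms(3,4) unfolding l' by auto
  then show "x = p l'" using link[of l] assms l' by simp
qed

text \<open>
  The first piece meets only the second one, and that at \<open>q 0\<close>, which differs from \<open>p 0\<close>.
\<close>

lemma first_end: "l < n \<Longrightarrow> p 0 \<in> A l \<Longrightarrow> l = 0"
  using meet(2)[of 0 l "p 0"] ends_in(1)[of 0] ends_ne[of 0] by fastforce

lemma last_end: "l < n \<Longrightarrow> q (n - 1) \<in> A l \<Longrightarrow> l = n - 1"
  using meet(3)[of l "n - 1" "q (n - 1)"] ends_in(2)[of "n - 1"] ends_ne[of "n - 1"] by fastforce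

lemma pieces_distinct: "l < n \<Longrightarrow> l' < n \<Longrightarrow> A l = A l' \<Longrightarrow> l = l'"
  using meet(2)[of l l' "p l"] meet(2)[of l' l "p l'"] ends_in(1)[of l] ends_in(1)[of l']
    ends_ne[of l] ends_ne[of l'] by (metis nat_neq_iff)

definition before :: "nat \<Rightarrow> 'a set" where "before l = (\<Union>l'<l. A l')"
definition after :: "nat \<Rightarrow> 'a set" where "after l = (\<Union>l'\<in>{l<..<n}. A l')"

lemma before_after_disjoint:
  assumes "l < n"
  shows "before l \<inter> after l = {}"
proof (rule ccontr)
  assume "before l \<inter> after l \<noteq> {}"
  then obtain x l1 l2 where "x \<in> A l1" "x \<in> A l2" "l1 < l" "l < l2" "l2 < n"
    unfolding before_def after_def by auto
  then show False using far[of l1 l2] by auto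
qed

lemma before_meet: "l < n \<Longrightarrow> x \<in> before l \<Longrightarrow> x \<in> A l \<Longrightarrow> x = p l"
  unfolding before_def by (auto dest: meet(3))

lemma after_meet: "l < n \<Longrightarrow> x \<in> after l \<Longrightarrow> x \<in> A l \<Longrightarrow> x = q l"
  unfolding after_def by (auto dest: meet(2))

text \<open>
  Pieces before and after \<open>A l\<close> touch it in \<open>p l\<close> and \<open>q l\<close>.  Applied to the images of the first and of the last
  piece of \<open>K\<close>, in the order given by the orientation, this shows that the step functions exist.
\<close>

lemma sides_disjoint:
  assumes l: "l < n" and XY: "X \<subseteq> A l" "Y \<subseteq> A l" "X \<inter> Y = {}" "p l \<notin> Y" "q l \<notin> X"
  shows "(before l \<union> X) \<inter> (after l \<union> Y) = {}"
  using before_after_disjoint[OF l] before_meet[OF l] after_meet[OF l] XY by blast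

end

text \<open>
  The endpoints of \<open>\<phi>\<^sub>i(K)\<close> are the images of the endpoints of \<open>K\<close>, and the latter belong to the first and the last
  piece of \<open>K\<close> only.  So the remaining inner part \<open>\<phi>\<^sub>i(M)\<close> misses all other pieces, and the orientation is read off
  from which image is the first endpoint of \<open>\<phi>\<^sub>i(K)\<close>.
\<close>

lemma zipper_Whitney_function:
  fixes A :: "nat \<Rightarrow> 'a::euclidean_space set" and \<phi> :: "nat \<Rightarrow> 'a \<Rightarrow> 'a"
  assumes zipper: "zipper_chain n A p q" and A_compact: "\<And>l. l < n \<Longrightarrow> compact (A l)"
    and K: "K = (\<Union>l<n. A l)"
    and N: "N \<noteq> 0" and w: "(\<Sum>i<N. w i) = 1" "\<And>i. i < N \<Longrightarrow> 0 \<le> w i \<and> w i \<le> c * \<rho> i" "c < 1"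
    and \<rho>: "\<And>i. i < N \<Longrightarrow> 0 < \<rho> i \<and> \<rho> i < 1"
    and dist: "\<And>i x y. i < N \<Longrightarrow> dist (\<phi> i x) (\<phi> i y) = \<rho> i * dist x y"
    and pos: "\<And>i. i < N \<Longrightarrow> 0 < pos i \<and> pos i < n - 1" "inj_on pos {..<N}"
    and A_pos: "\<And>i. i < N \<Longrightarrow> A (pos i) = \<phi> i ` K"
    and ends_pos: "\<And>i. i < N \<Longrightarrow> {p (pos i), q (pos i)} = {\<phi> i (p 0), \<phi> i (q (n - 1))}"
  obtains F G where "has_C1_gradient F G" "\<And>x. x \<in> A 0 \<Longrightarrow> F x = - 1"
    "\<And>x. x \<in> A (n - 1) \<Longrightarrow> F x = 1" "\<And>x. x \<in> K \<Longrightarrow> G x = 0"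
proof -
  interpret zipper_chain n A p q by (rule zipper)
  have n: "n > 2" using pos(1)[of 0] N by auto
  define M where "M = (\<Union>l\<in>{0<..<n - 1}. A l)"
  define \<epsilon> where "\<epsilon> i = (if p (pos i) = \<phi> i (p 0) then 1 else - 1 :: real)" for i
  have K_split: "K = A 0 \<union> M \<union> A (n - 1)"
  proof -
    have "{..<n} = insert 0 (insert (n - 1) {0<..<n - 1})" using n by auto
    then show ?thesis unfolding K M_def by auto
  qed
  have p0: "p 0 \<in> A 0" "p 0 \<notin> M" "p 0 \<notin> A (n - 1)"
  proof -
    show "p 0 \<in> A 0" using n by (intro ends_in) auto
    show "p 0 \<notin> A (n - 1)" using first_end[of "n - 1"] n by auto
    show "p 0 \<notin> M" unfolding M_def by (auto dest!: first_end[rotated])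
  qed
  have qn: "q (n - 1) \<in> A (n - 1)" "q (n - 1) \<notin> M" "q (n - 1) \<notin> A 0"
  proof -
    show "q (n - 1) \<in> A (n - 1)" using n by (intro ends_in) auto
    show "q (n - 1) \<notin> A 0" using last_end[of 0] n by auto
    show "q (n - 1) \<notin> M"
    proof
      assume "q (n - 1) \<in> M"
      then obtain l where l: "l \<in> {0<..<n - 1}" "q (n - 1) \<in> A l"
        unfolding M_def by blast
      from l(1) have "l < n" "l \<noteq> n - 1" by auto
      then show False using last_end l(2) by blast
    qed
  qed
  have ends_disjoint: "A 0 \<inter> A (n - 1) = {}" using far[of 0 "n - 1"] n by auto
  have inj: "\<phi> i x = \<phi> i y \<Longrightarrow> x = y" if "i < N" for i x y
    using dist[OF that, of x y] \<rho>[OF that] by simp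
  show thesis
  proof (rule exists_C1_self_similar_gluing[where I="{..<N}" and \<phi>=\<phi> and \<rho>=\<rho> and p=w and q=c
        and \<epsilon>=\<epsilon> and Lo="\<lambda>i. before (pos i)" and Hi="\<lambda>i. after (pos i)"
        and M=M and ?S0.0="A 0" and ?S1.0="A (n - 1)" and K=K])
    show "{..<N} \<noteq> {}" using N by auto
    show "finite {..<N}" by simp
    show "sum w {..<N} = 1" "c < 1" by (rule w)+
    show "compact M" using A_compact unfolding M_def by (intro compact_UN) auto
    show "compact (A 0)" "compact (A (n - 1))" using n by (auto intro: A_compact)
    show "A 0 \<noteq> {}" using p0 by blast
    show "K = A 0 \<union> M \<union> A (n - 1)" by (rule K_split)
  next
    fix i assume "i \<in> {..<N}"
    then have i: "i < N" by simp
    let ?l = "pos i"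
    have l: "?l < n" using pos(1)[OF i] by linarith
    show "0 \<le> w i \<and> w i \<le> c * \<rho> i" "0 < \<rho> i \<and> \<rho> i < 1" by (rule w(2)[OF i] \<rho>[OF i])+
    show "dist (\<phi> i x) (\<phi> i y) = \<rho> i * dist x y" for x y by (rule dist[OF i])
    show "compact (before ?l)" "compact (after ?l)"
      unfolding before_def after_def using A_compact l by (intro compact_UN; auto)+
    show "K \<subseteq> before ?l \<union> \<phi> i ` K \<union> after ?l"
    proof
      fix x assume "x \<in> K"
      then obtain l' where "l' < n" "x \<in> A l'" unfolding K by blast
      then show "x \<in> before ?l \<union> \<phi> i ` K \<union> after ?l"
        unfolding A_pos[OF i, symmetric] by (cases l' ?l rule: linorder_cases) (auto simp: before_def after_def)
    qed
    have "0 \<in> {..<?l}" "n - 1 \<in> {?l<..<n}" using pos(1)[OF i] by auto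
    then show "A 0 \<subseteq> before ?l \<and> A (n - 1) \<subseteq> after ?l"
      unfolding before_def after_def by blast
    have subs: "\<phi> i ` A 0 \<subseteq> A ?l" "\<phi> i ` M \<subseteq> A ?l" "\<phi> i ` A (n - 1) \<subseteq> A ?l"
      unfolding A_pos[OF i] K_split by auto
    have disj: "\<phi> i ` A 0 \<inter> \<phi> i ` A (n - 1) = {}"
      using ends_disjoint inj[OF i] by blast
    have notin: "\<phi> i (p 0) \<notin> \<phi> i ` M" "\<phi> i (q (n - 1)) \<notin> \<phi> i ` M"
      "\<phi> i (p 0) \<notin> \<phi> i ` A (n - 1)" "\<phi> i (q (n - 1)) \<notin> \<phi> i ` A 0"
      using p0 qn inj[OF i] by blast+
    have ends: "p ?l \<in> {\<phi> i (p 0), \<phi> i (q (n - 1))}" "q ?l \<in> {\<phi> i (p 0), \<phi> i (q (n - 1))}"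
      using ends_pos[OF i] by blast+
    show "\<phi> i ` M \<inter> (before ?l \<union> after ?l) = {}"
    proof (rule ccontr)
      assume "\<phi> i ` M \<inter> (before ?l \<union> after ?l) \<noteq> {}"
      then obtain x where x: "x \<in> \<phi> i ` M" "x \<in> before ?l \<or> x \<in> after ?l" by blast
      then have "x = p ?l \<or> x = q ?l" using before_meet[OF l] after_meet[OF l] subs(2) by blast
      then have "x = \<phi> i (p 0) \<or> x = \<phi> i (q (n - 1))" using ends by blast
      then show False using x(1) notin(1,2) by metis
    qed
    show "(\<epsilon> i = 1 \<and> (before ?l \<union> \<phi> i ` A 0) \<inter> (after ?l \<union> \<phi> i ` A (n - 1)) = {}) \<or>
      (\<epsilon> i = -1 \<and> (before ?l \<union> \<phi> i ` A (n - 1)) \<inter> (after ?l \<union> \<phi> i ` A 0) = {})"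
    proof (cases "p ?l = \<phi> i (p 0)")
      case True
      then have "q ?l = \<phi> i (q (n - 1))" using ends(2) ends_ne[OF l] by auto
      then have "p ?l \<notin> \<phi> i ` A (n - 1)" "q ?l \<notin> \<phi> i ` A 0" using True notin(3,4) by simp_all
      then have "(before ?l \<union> \<phi> i ` A 0) \<inter> (after ?l \<union> \<phi> i ` A (n - 1)) = {}"
        by (rule sides_disjoint[OF l subs(1,3) disj])
      then show ?thesis using True by (simp add: \<epsilon>_def)
    next
      case False
      then have "p ?l = \<phi> i (q (n - 1))" "q ?l = \<phi> i (p 0)"
        using ends ends_ne[OF l] by auto
      then have "p ?l \<notin> \<phi> i ` A 0" "q ?l \<notin> \<phi> i ` A (n - 1)" using notin(3,4) by simp_all
      moreover have "\<phi> i ` A (n - 1) \<inter> \<phi> i ` A 0 = {}" using disj by blast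
      ultimately have "(before ?l \<union> \<phi> i ` A (n - 1)) \<inter> (after ?l \<union> \<phi> i ` A 0) = {}"
        by (intro sides_disjoint[OF l subs(3,1)])
      then show ?thesis using False by (simp add: \<epsilon>_def)
    qed
    fix j assume "j \<in> {..<N}" "i \<noteq> j"
    then have j: "j < N" and "pos j \<noteq> ?l" using pos(2) i by (auto dest: inj_onD)
    then have "pos j < ?l \<or> ?l < pos j" by linarith
    then show "\<phi> j ` K \<subseteq> before ?l \<union> after ?l"
      using pos(1)[OF j] unfolding A_pos[OF j, symmetric] by (auto simp: before_def after_def)
  next
    fix F G assume "has_C1_gradient F G" "\<And>x. x \<in> A 0 \<Longrightarrow> F x = - 1"
      "\<And>x. x \<in> A (n - 1) \<Longrightarrow> F x = 1" "\<And>x. x \<in> K \<Longrightarrow> G x = 0"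
    then show thesis by (rule that)
  qed
qed

section \<open>Attractors of linear iterated function systems with condensation\<close>

theorem theorem1p2:
  fixes \<phi>s :: "('a::euclidean_space \<Rightarrow> 'a) list"
    and Cs As :: "'a button list"
    and K E :: "'a set"
    and a b :: 'a
  assumes "\<forall>\<phi>\<in>set \<phi>s. contractive_similitude \<phi>"
    and "linear_ifs_condensation Cs \<phi>s (K, {a, b}) As"
    and "ifs_attractor \<phi>s E"
    and "hd As \<in> set Cs" and "last As \<in> set Cs"
    and "hausdorff_dim E > 1"
  shows "Whitney_set K"
proof -
  let ?B = "(K, {a, b})"
  let ?imgs = "map (\<lambda>\<phi>. image_button \<phi> ?B) \<phi>s"
  define n where "n = length As"
  define A where "A l = fst (As ! l)" for l
  have lin: "\<forall>c\<in>set Cs. is_button c \<and> connected (fst c)" "compact K"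
    "mset As = mset (Cs @ ?imgs)" "zipper_decomposition ?B As"
    using assms(2) unfolding linear_ifs_condensation_def condensation_attractor_def fst_conv
    by - (elim conjE, assumption)+
  have zip: "1 \<le> n \<and> K = (\<Union>l<n. A l) \<and> (\<forall>l<n. sub_button (As ! l) ?B) \<and>
    (\<exists>a' b'. \<exists>p q :: nat \<Rightarrow> 'a.
           {a, b} = {a', b'} \<and> (\<forall>l<n. snd (As ! l) = {p l, q l}) \<and>
           a' = p 0 \<and> (\<forall>l. Suc l < n \<longrightarrow> q l = p (Suc l)) \<and> q (n - 1) = b') \<and>
    (\<forall>l<n. \<forall>l'<n. (\<bar>int l - int l'\<bar> > 1 \<longrightarrow> A l \<inter> A l' = {}) \<and>
      (\<bar>int l - int l'\<bar> = 1 \<longrightarrow> (\<exists>x. A l \<inter> A l' = {x})))"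
    using lin(4) unfolding zipper_decomposition_def Let_def n_def A_def fst_conv snd_conv .
  then have n: "1 \<le> n" and K_Union: "K = (\<Union>l<n. A l)"
    and sub: "\<forall>l<n. sub_button (As ! l) ?B"
    and inter: "\<forall>l<n. \<forall>l'<n. (\<bar>int l - int l'\<bar> > 1 \<longrightarrow> A l \<inter> A l' = {}) \<and>
      (\<bar>int l - int l'\<bar> = 1 \<longrightarrow> (\<exists>x. A l \<inter> A l' = {x}))"
    by - (elim conjE, assumption)+
  obtain p q where pq: "{a, b} = {p 0, q (n - 1)}" "\<And>l. l < n \<Longrightarrow> snd (As ! l) = {p l, q l}"
    "\<And>l. Suc l < n \<Longrightarrow> q l = p (Suc l)" using zip by metis
  have button: "is_button (As ! l)" if "l < n" for l using sub that by (simp add: sub_button_def)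
  have A_compact: "compact (A l)" if "l < n" for l
    using button[OF that] by (simp add: is_button_def A_def)
  interpret zipper_chain n A p q
  proof
    fix l assume l: "l < n"
    show "p l \<noteq> q l" using button[OF l] pq(2)[OF l] by (auto simp: is_button_def)
    show "p l \<in> A l" "q l \<in> A l" using button[OF l] pq(2)[OF l] by (auto simp: is_button_def A_def)
  next
    fix l assume "Suc l < n"
    then show "q l = p (Suc l)" "\<exists>x. A l \<inter> A (Suc l) = {x}" using pq(3) inter by auto
  next
    fix l l' assume "Suc l < l'" "l' < n"
    then show "A l \<inter> A l' = {}" using inter by simp
  qed
  have set_As: "set As = set Cs \<union> set ?imgs"
    using mset_eq_setD[OF lin(3)] by simp
  \<comment> \<open>Different positions carry different sets.  So the pieces at the two ends, being
    condensation components, are not images of \<open>K\<close> as well, and every map has its own position.\<close>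
  have "distinct As"
    unfolding distinct_conv_nth using pieces_distinct by (auto simp: A_def n_def)
  then have distinct: "distinct ?imgs" "set Cs \<inter> set ?imgs = {}"
    using mset_eq_imp_distinct_iff[OF lin(3)] by auto
  have "\<forall>\<phi>. \<exists>\<rho>. \<phi> \<in> set \<phi>s \<longrightarrow> 0 < \<rho> \<and> \<rho> < 1 \<and> (\<forall>x y. dist (\<phi> x) (\<phi> y) = \<rho> * dist x y)"
    using assms(1) unfolding contractive_similitude_def by blast
  then obtain \<rho> where \<rho>: "\<And>\<phi>. \<phi> \<in> set \<phi>s \<Longrightarrow> 0 < \<rho> \<phi> \<and> \<rho> \<phi> < 1"
    and dist: "\<And>\<phi> x y. \<phi> \<in> set \<phi>s \<Longrightarrow> dist (\<phi> x) (\<phi> y) = \<rho> \<phi> * dist x y"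
    by metis
  have inj: "inj \<phi>" if "\<phi> \<in> set \<phi>s" for \<phi>
    using dist[OF that] \<rho>[OF that] by (intro injI) (metis dist_eq_0_iff mult_eq_0_iff less_irrefl)
  have "connected K"
  \<comment> \<open>The entry \<open>1/2\<close> keeps the ratio positive even if there are no maps.\<close>
  proof (rule connected_iterated_chain[OF lin(2) K_Union, of "Max (insert (1/2) (\<rho> ` set \<phi>s))"])
    show "0 < Max (insert (1/2) (\<rho> ` set \<phi>s))" by (simp add: Max_gr_iff)
    show "Max (insert (1/2) (\<rho> ` set \<phi>s)) < 1" using \<rho> by auto
    show "A l \<inter> A (Suc l) \<noteq> {}" if "Suc l < n" for l using near[OF that] by blast
    fix l assume "l < n"
    then have "As ! l \<in> set Cs \<or> As ! l \<in> set ?imgs" using set_As nth_mem[of l As] n_def by blast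
    then show "connected (A l) \<or> (\<exists>\<phi>. A l = \<phi> ` K \<and>
        (\<forall>x y. dist (\<phi> x) (\<phi> y) \<le> Max (insert (1/2) (\<rho> ` set \<phi>s)) * dist x y))"
    proof
      assume "As ! l \<in> set ?imgs"
      then obtain \<phi> where "\<phi> \<in> set \<phi>s" "A l = \<phi> ` K" by (auto simp: A_def image_button_def)
      then show ?thesis using dist by (auto intro!: exI[of _ \<phi>] mult_right_mono)
    qed (use lin(1) in \<open>auto simp: A_def\<close>)
  qed
  define N where "N = length \<phi>s"
  let ?\<phi> = "\<lambda>i. \<phi>s ! i" and ?I = "{..<N}"
  have \<phi>_in: "?\<phi> i \<in> set \<phi>s" if "i < N" for i using that by (simp add: N_def)
  have "\<forall>i. \<exists>l. i < N \<longrightarrow> l < n \<and> As ! l = image_button (?\<phi> i) ?B"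
  proof clarify
    fix i
    show "\<exists>l. i < N \<longrightarrow> l < n \<and> As ! l = image_button (?\<phi> i) ?B"
    proof (cases "i < N")
      case True
      then have "image_button (?\<phi> i) ?B \<in> set As" using set_As \<phi>_in by simp
      then show ?thesis by (metis in_set_conv_nth n_def)
    qed auto
  qed
  then obtain pos where pos: "\<And>i. i < N \<Longrightarrow> pos i < n"
    "\<And>i. i < N \<Longrightarrow> As ! pos i = image_button (?\<phi> i) ?B" by metis
  have pos_inj: "inj_on pos ?I"
  proof (rule inj_onI)
    fix i j assume ij: "i \<in> ?I" "j \<in> ?I" "pos i = pos j"
    then have "?imgs ! i = ?imgs ! j" using pos(2)[of i] pos(2)[of j] by (simp add: N_def)
    then show "i = j" using nth_eq_iff_index_eq[OF distinct(1), of i j] ij by (simp add: N_def)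
  qed
  have A_pos: "A (pos i) = ?\<phi> i ` K" if "i < N" for i
    using pos(2)[OF that] by (simp add: A_def image_button_def)
  have ends_pos: "{p (pos i), q (pos i)} = {?\<phi> i (p 0), ?\<phi> i (q (n - 1))}" if "i < N" for i
    using pos[OF that] pq(2)[of "pos i"] pq(1) by (simp add: image_button_def)
  have pos_image: "As ! pos i \<in> set ?imgs" if "i < N" for i
    using pos(2)[OF that] \<phi>_in[OF that] by simp
  have "As \<noteq> []" using n n_def by auto
  then have first_last: "As ! 0 \<in> set Cs" "As ! (n - 1) \<in> set Cs"
    using assms(4,5) by (simp_all add: hd_conv_nth last_conv_nth n_def)
  have pos_strict: "0 < pos i \<and> pos i < n - 1" if "i < N" for i
  proof -
    have "As ! pos i \<notin> set Cs" using pos_image[OF that] distinct(2) by blast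
    then have "pos i \<noteq> 0" "pos i \<noteq> n - 1" using first_last by metis+
    then show ?thesis using pos(1)[OF that] by linarith
  qed
  obtain t where t: "t > 1" "(\<Sum>\<phi>\<leftarrow>\<phi>s. \<rho> \<phi> powr t) \<ge> 1"
    using hausdorff_dim_gt_1_imp_sum_powr_ge_1[OF \<rho> dist assms(3,6)] by blast
  then have sum: "1 \<le> (\<Sum>i<N. \<rho> (?\<phi> i) powr t)"
    by (simp add: sum_list_sum_nth N_def atLeast0LessThan)
  obtain w c where w: "(\<Sum>i<N. w i) = 1" "\<And>i. i < N \<Longrightarrow> 0 \<le> w i \<and> w i \<le> c * \<rho> (?\<phi> i)" "c < (1::real)"
    by (rule similitude_weights[OF _ t(1) sum]) (use \<rho> \<phi>_in in auto)
  have "N \<noteq> 0" using sum by (cases N) auto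
  obtain F G where FG: "has_C1_gradient F G" "\<And>x. x \<in> A 0 \<Longrightarrow> F x = - 1"
    "\<And>x. x \<in> A (n - 1) \<Longrightarrow> F x = 1" "\<And>x. x \<in> K \<Longrightarrow> G x = 0"
  proof (rule zipper_Whitney_function[OF zipper_chain_axioms A_compact K_Union \<open>N \<noteq> 0\<close> w
        \<rho>[OF \<phi>_in] dist[OF \<phi>_in] pos_strict pos_inj A_pos ends_pos])
    fix F G assume "has_C1_gradient F G" "\<And>x. x \<in> A 0 \<Longrightarrow> F x = - 1"
      "\<And>x. x \<in> A (n - 1) \<Longrightarrow> F x = 1" "\<And>x. x \<in> K \<Longrightarrow> G x = 0"
    then show thesis by (rule that)
  qed
  have p0: "p 0 \<in> A 0" and qn: "q (n - 1) \<in> A (n - 1)"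
    using n by (auto intro: ends_in)
  have "\<not> F constant_on K"
  proof
    assume "F constant_on K"
    moreover have "0 < n" "n - 1 < n" using n by auto
    then have "p 0 \<in> K" "q (n - 1) \<in> K" unfolding K_Union using p0 qn by blast+
    ultimately have "F (p 0) = F (q (n - 1))" unfolding constant_on_def by metis
    then show False using FG(2)[OF p0] FG(3)[OF qn] by simp
  qed
  then show "Whitney_set K"
    unfolding Whitney_set_def using lin(2) \<open>connected K\<close> FG(1,4)
    by (auto simp: has_C1_gradient_def)
qed

end
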